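(* Let $A\in\mathbb{H}^{n}_{\sup}$ and $C\in\mathbb{H}^{r\times n}_{\sup}$. Let $\mathcal{M}=[\tau_{\min},\tau_{\max}]^p$ be divided into $N$ disjoint boxes $\{\mathcal{B}_i\}_{i=1}^N$ with union $\mathcal{M}$, and let $c_i\in\mathcal{B}_i$ for each $i$. For each $i=1,\dots,N$ define $w_i(\phi):=\int_{\mathcal{B}_i}g(\phi,\ell)\mu(d\ell)$ for $\phi\in\mathcal{M}$, and $$\begin{bmatrix}\Upsilon_{A,i}\\ \Upsilon_{C,i}\end{bmatrix}:=\begin{bmatrix}A(c_i)\\ C(c_i)\end{bmatrix},\qquad \Upsilon_{w,i}:=\begin{bmatrix}\sqrt{w_1(c_i)}I&\cdots&\sqrt{w_N(c_i)}I\end{bmatrix},$$ where $I$ is the $n\times n$ identity. Assume that for all $i=1,\dots,N$ scalars $\kappa_{A,i},\kappa_{w,i}>0$ satisfy $$\left\|\begin{bmatrix}A(\phi)\\ C(\phi)\end{bmatrix}-\begin{bmatrix}\Upsilon_{A,i}\\ \Upsilon_{C,i}\end{bmatrix}\right\|\le\kappa_{A,i},\qquad \left\|\begin{bmatrix}\sqrt{w_1(\phi)}I&\cdots&\sqrt{w_N(\phi)}I\end{bmatrix}-\Upsilon_{w,i}\right\|\le\kappa_{w,i}$$ for $\mu$-almost every $\phi\in\mathcal{B}_i$. If there exist positive definite matrices $S_i\in\mathbb{R}^{n\times n}$, (not necessarily symmetric) matrices $U_i\in\mathbb{R}^{n\times n}$, $\bar L_i\in\mathbb{R}^{n\times r}$,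 and scalars $\lambda_i,\rho_i>0$ such that the linear matrix inequalities $$\begin{bmatrix}U_i+U_i^{\top}&0&U_i\Upsilon_{A,i}+\bar L_i\Upsilon_{C,i}&\kappa_{A,i}\begin{bmatrix}U_i&\bar L_i\end{bmatrix}&0&\Upsilon_{w,i}\bm{S}&\rho_iI\\ \star&\lambda_iI&\lambda_iI&0&0&0&0\\ \star&\star&S_i&0&0&0&0\\ \star&\star&\star&\lambda_iI&0&0&0\\ \star&\star&\star&\star&\rho_iI&\kappa_{w,i}\bm{S}&0\\ \star&\star&\star&\star&\star&\bm{S}&0\\ \star&\star&\star&\star&\star&\star&\rho_iI\end{bmatrix}>0$$ hold for all $i=1,\dots,N$, where $\bm{S}:=\mathrm{diag}(S_1,\dots,S_N)$, then the pair $(C,A)$ is stochastically detectable by the piecewise-constant observer gain $L\in\mathbb{H}^{n\times r}_{\sup}$ defined by $L(\phi):=L_i$ for $\phi\in\mathcal{B}_i$, with $L_i:=U_i^{-1}\bar L_i$.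
   Context: $\mathcal{M}=[\tau_{\min},\tau_{\max}]^p\subset\mathbb{R}^p$, with its Borel $\sigma$-algebra and a $\sigma$-finite measure $\mu$. $g(\cdot,\cdot)$ is the transition density with respect to $\mu$ of a time-homogeneous Markov chain $\{\phi_k\}$ in $\mathcal{M}$: $P(\phi_{k+1}\in\mathcal{B}\mid\phi_k=\phi)=\int_{\mathcal{B}}g(\phi,\ell)\mu(d\ell)$ for all Borel $\mathcal{B}\subset\mathcal{M}$. A box is a product of $p$ intervals. $\mathbb{H}^{n\times m}_{\sup}$ is the space of measurable, essentially bounded functions $\mathcal{M}\to\mathbb{R}^{n\times m}$, and $\mathbb{H}^n_{\sup}:=\mathbb{H}^{n\times n}_{\sup}$. $\mathbb{H}^n_{1,\mathbb{C}}$ is the space of measurable, $\mu$-integrable functions $\mathcal{M}\to\mathbb{C}^{n\times n}$. For $A\in\mathbb{H}^n_{\sup}$ define $\mathcal{L}_A:\mathbb{H}^n_{1,\mathbb{C}}\to\mathbb{H}^n_{1,\mathbb{C}}$ by $$\mathcal{L}_A(V)(\cdot):=\int_{\mathcal{M}}g(\ell,\cdot)A(\ell)V(\ell)A(\ell)^{\top}\mu(d\ell),$$ and let $r_\sigma$ denote the spectral radius. $(C,A)$ is stochastically detectable if there is $L\in\mathbb{H}^{n\times r}_{\sup}$ with $r_\sigma(\mathcal{L}_{A+LC})<1$; in that case $(C,A)$ is said to be stochastically detectable by the observer gain $L$. $\|\cdot\|$ is the matrix norm induced by the Euclidean norm; $\star$ denotes blocks determined by symmetry; $>0$ means symmetric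 positive definite. Block sizes in the inequality are $n,n,n,n+r,nN,nN,n$. *)

theory Defs
  imports "HOL-Probability.Probability"
begin

definition tau_cube :: "real \<Rightarrow> real \<Rightarrow> (real ^ 'p) set" where
  "tau_cube a b = {x. \<forall>k. x $ k \<in> {a..b}}"

text \<open>A box may be open, closed or half-open in each coordinate.\<close>

definition is_box :: "(real ^ 'p) set \<Rightarrow> bool" where
  "is_box B \<longleftrightarrow> (\<exists>J :: 'p \<Rightarrow> real set. (\<forall>k. is_interval (J k)) \<and> B = {x. \<forall>k. x $ k \<in> J k})"

text \<open>
  The measure \<open>density \<mu> (g \<phi>)\<close> maps \<open>B\<close> to the integral of \<open>g \<phi>\<close> over \<open>B\<close> with
  respect to \<open>\<mu>\<close>. It is the conditional law of the next state of the chain given that the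
  current state is \<open>\<phi>\<close>, hence a probability measure for every \<open>\<phi>\<close>.
\<close>

definition transition_density :: "'a measure \<Rightarrow> ('a \<Rightarrow> 'a \<Rightarrow> real) \<Rightarrow> bool" where
  "transition_density \<mu> g \<longleftrightarrow>
     (\<lambda>(\<phi>, l). g \<phi> l) \<in> borel_measurable (\<mu> \<Otimes>\<^sub>M \<mu>) \<and>
     (\<forall>\<phi>\<in>space \<mu>. \<forall>l\<in>space \<mu>. 0 \<le> g \<phi> l) \<and>
     (\<forall>\<phi>\<in>space \<mu>. prob_space (density \<mu> (\<lambda>l. ennreal (g \<phi> l))))"

definition mat_norm :: "real ^ 'm ^ 'n \<Rightarrow> real" where
  "mat_norm X = onorm (\<lambda>x. X *v x)"

definition pos_def :: "real ^ 'n ^ 'n \<Rightarrow> bool" where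
  "pos_def X \<longleftrightarrow> transpose X = X \<and> (\<forall>x. x \<noteq> 0 \<longrightarrow> 0 < x \<bullet> (X *v x))"


section \<open>Function spaces, the operator and its spectral radius\<close>

definition H_sup :: "'a measure \<Rightarrow> ('a \<Rightarrow> real ^ 'm ^ 'n) set" where
  "H_sup \<mu> = {F \<in> borel_measurable \<mu>. \<exists>c. AE \<phi> in \<mu>. mat_norm (F \<phi>) \<le> c}"

text \<open>
  The set below consists of functions, not of equivalence classes. The Banach space is its
  quotient by almost everywhere equality. It is normed by \<open>H1_norm\<close>, which uses the entrywise
  Euclidean norm of matrices; any other matrix norm gives an equivalent norm and hence the same
  spectrum.
\<close>

definition H1 :: "'a measure \<Rightarrow> ('a \<Rightarrow> complex ^ 'n ^ 'n) set" where
  "H1 \<mu> = {V. integrable \<mu> V}"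

definition H1_norm :: "'a measure \<Rightarrow> ('a \<Rightarrow> complex ^ 'n ^ 'n) \<Rightarrow> real" where
  "H1_norm \<mu> V = (LINT \<phi>|\<mu>. norm (V \<phi>))"

definition cmat :: "real ^ 'm ^ 'n \<Rightarrow> complex ^ 'm ^ 'n" where
  "cmat X = (\<chi> i j. complex_of_real (X $ i $ j))"

definition cscale :: "complex \<Rightarrow> complex ^ 'm ^ 'n \<Rightarrow> complex ^ 'm ^ 'n" where
  "cscale z X = (\<chi> i j. z * X $ i $ j)"

text \<open>
  For essentially bounded \<open>A\<close> and integrable \<open>V\<close> the integral below exists for almost every
  \<open>\<phi>\<close>; on the exceptional null set its value is immaterial (the library returns \<open>0\<close>).
\<close>

definition L_op ::
  "'a measure \<Rightarrow> ('a \<Rightarrow> 'a \<Rightarrow> real) \<Rightarrow> ('a \<Rightarrow> real ^ 'n ^ 'n) \<Rightarrow>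
     ('a \<Rightarrow> complex ^ 'n ^ 'n) \<Rightarrow> ('a \<Rightarrow> complex ^ 'n ^ 'n)" where
  "L_op \<mu> g A V =
     (\<lambda>\<phi>. LINT l|\<mu>. g l \<phi> *\<^sub>R (cmat (A l) ** V l ** transpose (cmat (A l))))"

text \<open>
  Resolvent set of the operator induced by \<open>T\<close> on the quotient space, written out on
  representatives: \<open>z - T\<close> is injective and surjective, and its inverse is bounded.
\<close>

definition resolvent_set ::
  "'a measure \<Rightarrow> (('a \<Rightarrow> complex ^ 'n ^ 'n) \<Rightarrow> ('a \<Rightarrow> complex ^ 'n ^ 'n)) \<Rightarrow> complex set" where
  "resolvent_set \<mu> T =
     {z. (\<forall>V\<in>H1 \<mu>. (AE \<phi> in \<mu>. cscale z (V \<phi>) - T V \<phi> = 0) \<longrightarrow> (AE \<phi> in \<mu>. V \<phi> = 0)) \<and>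
         (\<exists>K. \<forall>W\<in>H1 \<mu>. \<exists>V\<in>H1 \<mu>.
            (AE \<phi> in \<mu>. cscale z (V \<phi>) - T V \<phi> = W \<phi>) \<and> H1_norm \<mu> V \<le> K * H1_norm \<mu> W)}"

definition spectrum_set ::
  "'a measure \<Rightarrow> (('a \<Rightarrow> complex ^ 'n ^ 'n) \<Rightarrow> ('a \<Rightarrow> complex ^ 'n ^ 'n)) \<Rightarrow> complex set" where
  "spectrum_set \<mu> T = - resolvent_set \<mu> T"

text \<open>The supremum is taken in \<open>ennreal\<close>, so that an unbounded spectrum would give \<open>\<infinity>\<close>.\<close>

definition spec_radius ::
  "'a measure \<Rightarrow> (('a \<Rightarrow> complex ^ 'n ^ 'n) \<Rightarrow> ('a \<Rightarrow> complex ^ 'n ^ 'n)) \<Rightarrow> ennreal" where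
  "spec_radius \<mu> T = (SUP z\<in>spectrum_set \<mu> T. ennreal (cmod z))"

definition stoch_detectable_by ::
  "'a measure \<Rightarrow> ('a \<Rightarrow> 'a \<Rightarrow> real) \<Rightarrow> ('a \<Rightarrow> real ^ 'n ^ 'r) \<Rightarrow> ('a \<Rightarrow> real ^ 'n ^ 'n) \<Rightarrow>
     ('a \<Rightarrow> real ^ 'r ^ 'n) \<Rightarrow> bool" where
  "stoch_detectable_by \<mu> g C A L \<longleftrightarrow>
     L \<in> H_sup \<mu> \<and> spec_radius \<mu> (L_op \<mu> g (\<lambda>\<phi>. A \<phi> + L \<phi> ** C \<phi>)) < 1"


section \<open>Block matrices\<close>

text \<open>
  Rows and columns of block matrices are indexed by sum types. A family of \<open>N\<close> blocks of size
  \<open>n\<close>, with the blocks indexed by a finite type \<open>'k\<close> of cardinality \<open>N\<close>, is indexed by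
  \<open>'k \<times> 'n\<close>.
\<close>

definition vstack :: "real ^ 'm ^ 'a \<Rightarrow> real ^ 'm ^ 'b \<Rightarrow> real ^ 'm ^ ('a + 'b)" where
  "vstack X Y = (\<chi> i. case i of Inl a \<Rightarrow> X $ a | Inr b \<Rightarrow> Y $ b)"

definition hstack :: "real ^ 'a ^ 'm \<Rightarrow> real ^ 'b ^ 'm \<Rightarrow> real ^ ('a + 'b) ^ 'm"
    (infixr \<open>\<^bold>|\<close> 60) where
  "X \<^bold>| Y = (\<chi> i j. case j of Inl a \<Rightarrow> X $ i $ a | Inr b \<Rightarrow> Y $ i $ b)"

text \<open>The symmetric completion with upper blocks \<open>D\<close>, \<open>R\<close> and lower right block \<open>E\<close>.\<close>

definition sym_block ::
  "real ^ 'a ^ 'a \<Rightarrow> real ^ 'b ^ 'a \<Rightarrow> real ^ 'b ^ 'b \<Rightarrow> real ^ ('a + 'b) ^ ('a + 'b)" where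
  "sym_block D R E = vstack (D \<^bold>| R) (transpose R \<^bold>| E)"

definition block_diag :: "('k::finite \<Rightarrow> real ^ 'n ^ 'n) \<Rightarrow> real ^ ('k \<times> 'n) ^ ('k \<times> 'n)" where
  "block_diag S = (\<chi> p q. if fst p = fst q then S (fst p) $ snd p $ snd q else 0)"

text \<open>The row of blocks \<open>sqrt (w j) I\<close>, where \<open>j\<close> ranges over \<open>'k\<close>.\<close>

definition sqrt_row :: "('k::finite \<Rightarrow> real) \<Rightarrow> real ^ ('k \<times> 'n) ^ 'n" where
  "sqrt_row w = (\<chi> a q. (sqrt (w (fst q)) *\<^sub>R (mat 1 :: real ^ 'n ^ 'n)) $ a $ snd q)"

definition box_weight ::
  "'a measure \<Rightarrow> ('a \<Rightarrow> 'a \<Rightarrow> real) \<Rightarrow> ('k \<Rightarrow> 'a set) \<Rightarrow> 'a \<Rightarrow> 'k \<Rightarrow> real" where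
  "box_weight \<mu> g B \<phi> j = (LINT l:B j|\<mu>. g \<phi> l)"

text \<open>
  \<open>YA\<close>, \<open>YC\<close>, \<open>Yw\<close> are the nominal values of the coefficients on the box in question, and
  \<open>Sblk\<close> is the block of \<open>S\<close> belonging to it. The nesting of \<open>sym_block\<close> follows the rows of
  the upper triangle, starting at the diagonal.
\<close>

definition lmi_matrix ::
  "real ^ 'n ^ 'n \<Rightarrow> real ^ 'n ^ 'r \<Rightarrow> real ^ ('k::finite \<times> 'n) ^ 'n \<Rightarrow> real \<Rightarrow> real \<Rightarrow>
   ('k \<Rightarrow> real ^ 'n ^ 'n) \<Rightarrow> real ^ 'n ^ 'n \<Rightarrow> real ^ 'n ^ 'n \<Rightarrow> real ^ 'r ^ 'n \<Rightarrow> real \<Rightarrow> real \<Rightarrow>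
   real ^ ('n + 'n + 'n + ('n + 'r) + ('k \<times> 'n) + ('k \<times> 'n) + 'n)
        ^ ('n + 'n + 'n + ('n + 'r) + ('k \<times> 'n) + ('k \<times> 'n) + 'n)" where
  "lmi_matrix YA YC Yw \<kappa>A \<kappa>w S Sblk U Lb lam \<rho> =
     sym_block (U + transpose U)
       (0 \<^bold>| U ** YA + Lb ** YC \<^bold>| \<kappa>A *\<^sub>R (U \<^bold>| Lb) \<^bold>| 0 \<^bold>| Yw ** block_diag S \<^bold>| \<rho> *\<^sub>R mat 1)
    (sym_block (lam *\<^sub>R mat 1)
       (lam *\<^sub>R mat 1 \<^bold>| 0 \<^bold>| 0 \<^bold>| 0 \<^bold>| 0)
    (sym_block Sblk
       (0 \<^bold>| 0 \<^bold>| 0 \<^bold>| 0)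
    (sym_block (lam *\<^sub>R mat 1)
       (0 \<^bold>| 0 \<^bold>| 0)
    (sym_block (\<rho> *\<^sub>R mat 1)
       (\<kappa>w *\<^sub>R block_diag S \<^bold>| 0)
    (sym_block (block_diag S)
       0
       (\<rho> *\<^sub>R mat 1))))))"

end

theory Submission
  imports Defs
begin

text \<open>
  Write \<open>a\<close> for the closed loop matrix \<open>A + L C\<close> and \<open>Q(\<phi>) = \<Sum>\<^sub>j w j(\<phi>) S j\<close> for the average of
  the matrices \<open>S j\<close> under the law of the next mode. The proof has two independent halves.

  The first half is linear algebra on one box. Positive definiteness of the big matrix means that its
  quadratic form is bounded below by a positive multiple of the squared norm. A suitable test vector
  (\<open>robust_lmi\<close>, \<open>closed_loop_decrease\<close>) turns this, for almost every mode \<open>\<phi>\<close> in box \<open>i\<close>, into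
  \<open>a(\<phi>)\<^sup>T Q(\<phi>) a(\<phi>) \<le> S i - e I\<close>. So the function equal to \<open>S i\<close> on box \<open>i\<close> defines a
  Lyapunov function whose expected value decreases by a factor \<open>r < 1\<close> in each step.

  The second half shows that such a Lyapunov function forces the spectral radius of the operator to be
  at most \<open>r\<close> (\<open>spec_radius_le\<close>). On positive semidefinite fields \<open>V\<close> the operator contracts the
  integral of \<open>tr (S V)\<close>, but the space consists of arbitrary complex fields. They are handled by
  duality: the fields \<open>F\<close> with \<open>2 |x\<^sup>T F y| \<le> x\<^sup>T S x + y\<^sup>T S y\<close> for real \<open>x\<close> and \<open>y\<close>
  form the unit ball of a dual norm, and the adjoint operator maps this ball into its multiple by
  \<open>r\<close> (\<open>dominated_adjoint\<close>). The resulting norm is equivalent to the given one and the operator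
  contracts it by \<open>r\<close>, so that the Neumann series inverts \<open>z - T\<close> whenever \<open>|z| > r\<close>.
\<close>

section \<open>Quadratic forms of block matrices\<close>

definition vjoin :: "real ^ 'a \<Rightarrow> real ^ 'b \<Rightarrow> real ^ ('a + 'b)" where
  "vjoin x y = (\<chi> i. case i of Inl a \<Rightarrow> x $ a | Inr b \<Rightarrow> y $ b)"

lemma sum_UNIV_Plus:
  fixes f :: "'a::finite + 'b::finite \<Rightarrow> real"
  shows "(\<Sum>i\<in>UNIV. f i) = (\<Sum>a\<in>UNIV. f (Inl a)) + (\<Sum>b\<in>UNIV. f (Inr b))"
  by (simp add: sum.Plus flip: UNIV_Plus_UNIV)

lemma inner_vjoin: "vjoin x y \<bullet> vjoin x' y' = x \<bullet> x' + y \<bullet> y'"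
  by (simp add: inner_vec_def vjoin_def sum_UNIV_Plus)

lemma hstack_vjoin: "(X \<^bold>| Y) *v vjoin x y = X *v x + Y *v y"
  by (simp add: vec_eq_iff matrix_vector_mult_def hstack_def vjoin_def sum_UNIV_Plus)

lemma vstack_mult: "vstack X Y *v x = vjoin (X *v x) (Y *v x)"
  by (auto simp add: vec_eq_iff matrix_vector_mult_def vstack_def vjoin_def split: sum.split)

text \<open>
  Quadratic forms of nested symmetric block matrices are computed with this rule, which peels
  off the first row and column.
\<close>

lemma sym_block_quadratic:
  "vjoin x y \<bullet> (sym_block D R E *v vjoin x y)
     = x \<bullet> (D *v x) + 2 * (x \<bullet> (R *v y)) + y \<bullet> (E *v y)"
proof -
  have "y \<bullet> (transpose R *v x) = x \<bullet> (R *v y)"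
    by (metis dot_lmul_matrix inner_commute transpose_matrix_vector)
  then show ?thesis
    by (simp add: sym_block_def vstack_mult hstack_vjoin inner_vjoin inner_right_distrib)
qed

text \<open>
  The quadratic form attains a positive minimum on the compact unit sphere; homogeneity does the
  rest.
\<close>

lemma pos_def_uniform:
  assumes "pos_def X"
  shows "\<exists>e>0. \<forall>x. e * (x \<bullet> x) \<le> x \<bullet> (X *v x)"
proof -
  let ?q = "\<lambda>x. x \<bullet> (X *v x)"
  have "continuous_on (sphere 0 1) ?q"
    by (intro continuous_on_inner continuous_on_id linear_continuous_on matrix_vector_mul_bounded_linear)
  moreover have "sphere 0 1 \<noteq> ({} :: (real^'a) set)"
    by (simp)
  ultimately obtain m where m: "m \<in> sphere 0 1" "\<forall>x\<in>sphere 0 1. ?q m \<le> ?q x"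
    using continuous_attains_inf[OF compact_sphere, of 0 1 ?q] by auto
  have "m \<noteq> 0" using m(1) by auto
  then have pos: "0 < ?q m" using assms by (simp add: pos_def_def)
  have "?q m * (x \<bullet> x) \<le> ?q x" for x
  proof (cases "x = 0")
    case False
    have "?q m \<le> ?q ((1 / norm x) *\<^sub>R x)"
      by (rule m(2)[rule_format]) (use False in simp)
    also have "\<dots> = ?q x / (norm x)\<^sup>2"
      by (simp add: power2_eq_square matrix_vector_mult_scaleR)
    finally show ?thesis
      using False by (simp add: field_simps power2_norm_eq_inner)
  qed simp
  with pos show ?thesis by blast
qed

lemma mat_norm_bound:
  assumes "mat_norm X \<le> k"
  shows "norm (X *v x) \<le> k * norm x"
  using onorm[OF matrix_vector_mul_bounded_linear[of X], of x] assms
  unfolding mat_norm_def by (meson mult_right_mono norm_ge_zero order_trans)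

text \<open>
  The spectral norm is invariant under transposition:
  \<open>|X\<^sup>T y|\<^sup>2 = y \<bullet> X (X\<^sup>T y) \<le> |y| k |X\<^sup>T y|\<close>.
\<close>

lemma mat_norm_bound_transpose:
  assumes "mat_norm X \<le> k"
  shows "norm (transpose X *v y) \<le> k * norm y"
proof (cases "transpose X *v y = 0")
  case True
  have "0 \<le> k"
    using assms onorm_pos_le[OF matrix_vector_mul_bounded_linear[of X]] by (simp add: mat_norm_def)
  with True show ?thesis by simp
next
  case False
  let ?t = "transpose X *v y"
  have "norm ?t * norm ?t = y \<bullet> (X *v ?t)"
    by (metis dot_lmul_matrix dot_square_norm power2_eq_square transpose_matrix_vector inner_commute)
  also have "\<dots> \<le> norm y * norm (X *v ?t)" by (rule norm_cauchy_schwarz)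
  also have "\<dots> \<le> norm y * (k * norm ?t)"
    by (intro mult_left_mono mat_norm_bound assms) simp
  finally have "norm ?t * norm ?t \<le> (k * norm y) * norm ?t" by (simp add: ac_simps)
  with False show ?thesis by (simp)
qed

text \<open>
  This is where the square roots of the weights disappear: if \<open>W\<close> is the row of the blocks
  \<open>sqrt (w j) I\<close>, then \<open>W diag(S) W\<^sup>T = \<Sum>\<^sub>j w j S j\<close>, the average of the
  matrices \<open>S j\<close> under the law of the next state.
\<close>

lemma sqrt_row_weighted_sum:
  fixes S :: "'k::finite \<Rightarrow> real^'n^'n"
  assumes "\<And>j. 0 \<le> w j"
  shows "(transpose (sqrt_row w) *v y) \<bullet> (block_diag S *v (transpose (sqrt_row w) *v y))
       = (\<Sum>j\<in>UNIV. w j * (y \<bullet> (S j *v y)))"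
proof -
  define t where "t = transpose (sqrt_row w :: real ^ ('k \<times> 'n) ^ 'n) *v y"
  have t: "t $ q = sqrt (w (fst q)) * y $ snd q" for q
    by (simp add: t_def matrix_vector_mult_def transpose_def sqrt_row_def mat_def
          if_distrib[of "\<lambda>x. _ * x"] if_distrib[of "\<lambda>x. x * _"] cong: if_cong
          del: transpose_matrix_vector)
  have b: "(block_diag S *v t) $ q = sqrt (w (fst q)) * (S (fst q) *v y) $ snd q" for q
  proof -
    have "(block_diag S *v t) $ q
        = (\<Sum>j\<in>UNIV. \<Sum>b\<in>UNIV. (if fst q = j then S (fst q) $ snd q $ b else 0)
              * (sqrt (w j) * y $ b))"
      unfolding matrix_vector_mult_def[of "block_diag S"]
      by (simp add: t block_diag_def sum.cartesian_product case_prod_unfold)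
    also have "\<dots> = (\<Sum>j\<in>UNIV. if fst q = j then
        (\<Sum>b\<in>UNIV. S (fst q) $ snd q $ b * (sqrt (w j) * y $ b)) else 0)"
      by (intro sum.cong) auto
    also have "\<dots> = sqrt (w (fst q)) * (S (fst q) *v y) $ snd q"
      by (simp add: matrix_vector_mult_def sum_distrib_left ac_simps)
    finally show ?thesis .
  qed
  have sq: "sqrt (w j) * a * (sqrt (w j) * b) = w j * (a * b)" for j a b
    using assms[of j] by (metis mult.assoc mult.left_commute real_sqrt_mult_self abs_of_nonneg)
  have "t \<bullet> (block_diag S *v t)
      = (\<Sum>j\<in>UNIV. \<Sum>a\<in>UNIV. sqrt (w j) * y $ a * (sqrt (w j) * (S j *v y) $ a))"
    unfolding inner_vec_def[of t] t b
    by (simp add: sum.cartesian_product case_prod_unfold)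
  also have "\<dots> = (\<Sum>j\<in>UNIV. w j * (y \<bullet> (S j *v y)))"
    by (simp add: sq inner_vec_def sum_distrib_left)
  finally show ?thesis unfolding t_def .
qed

section \<open>Closed loop decrease from the linear matrix inequality\<close>

lemma dot_matrix_transpose:
  fixes X :: "real ^ 'm ^ 'n"
  shows "(transpose X *v x) \<bullet> y = x \<bullet> (X *v y)"
  by (simp add: dot_lmul_matrix)

lemma inner_scaled_le:
  fixes d :: "'a::real_inner" and v :: "'b::real_inner"
  assumes "norm d \<le> k * norm v" "0 < k"
  shows "((1 / k) *\<^sub>R d) \<bullet> ((1 / k) *\<^sub>R d) \<le> v \<bullet> v"
proof -
  have "norm ((1 / k) *\<^sub>R d) \<le> norm v"
    using assms by (simp add: divide_le_eq mult.commute)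
  then have "(norm ((1 / k) *\<^sub>R d))\<^sup>2 \<le> (norm v)\<^sup>2"
    by (rule power_mono) simp
  then show ?thesis by (simp only: power2_norm_eq_inner)
qed

lemma lmi_matrix_quadratic:
  fixes YA :: "real ^ 'n ^ 'n" and YC :: "real ^ 'n ^ 'r" and Yw :: "real ^ ('k::finite \<times> 'n) ^ 'n"
  shows "vjoin x1 (vjoin x2 (vjoin x3 (vjoin x4 (vjoin x5 (vjoin x6 x7))))) \<bullet>
    (lmi_matrix YA YC Yw \<kappa>A \<kappa>w S Sb U Lb lam \<rho> *v
      vjoin x1 (vjoin x2 (vjoin x3 (vjoin x4 (vjoin x5 (vjoin x6 x7))))))
   = 2 * (x1 \<bullet> (U *v x1)) + 2 * (x1 \<bullet> ((U ** YA + Lb ** YC) *v x3))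
     + 2 * \<kappa>A * (x1 \<bullet> ((U \<^bold>| Lb) *v x4)) + 2 * (x1 \<bullet> (Yw *v (block_diag S *v x6)))
     + 2 * \<rho> * (x1 \<bullet> x7) + lam * (x2 \<bullet> x2) + 2 * lam * (x2 \<bullet> x3)
     + x3 \<bullet> (Sb *v x3) + lam * (x4 \<bullet> x4) + \<rho> * (x5 \<bullet> x5)
     + 2 * \<kappa>w * (x5 \<bullet> (block_diag S *v x6)) + x6 \<bullet> (block_diag S *v x6) + \<rho> * (x7 \<bullet> x7)"
proof -
  have U: "x1 \<bullet> (transpose U *v x1) = x1 \<bullet> (U *v x1)"
    by (metis dot_lmul_matrix inner_commute transpose_matrix_vector)
  show ?thesis
    unfolding lmi_matrix_def sym_block_quadratic hstack_vjoin
    by (simp add: matrix_vector_mult_add_rdistrib inner_right_distrib U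
        flip: matrix_vector_mul_assoc scaleR_matrix_vector_assoc del: transpose_matrix_vector)
qed

text \<open>
  The two uncertain coefficients are eliminated by a choice of test vector, without any matrix
  inversion. Let \<open>d\<close> be the change of \<open>[A; C] v\<close> and \<open>f\<close> that of \<open>W\<^sup>T y\<close> when the
  nominal values are replaced by the actual ones. The fourth and fifth components \<open>d / \<kappa>A\<close> and
  \<open>f / \<kappa>w\<close> turn the off-diagonal blocks with \<open>\<kappa>A\<close> and \<open>\<kappa>w\<close> into exactly the missing
  cross terms. Their cost \<open>lam |d / \<kappa>A|\<^sup>2 \<le> lam |v|\<^sup>2\<close> and
  \<open>\<rho> |f / \<kappa>w|\<^sup>2 \<le> \<rho> |y|\<^sup>2\<close> is repaid by the second and the seventh component, which
  contribute \<open>- lam |v|\<^sup>2\<close> at \<open>- v\<close> and \<open>- \<rho> |y|\<^sup>2\<close> at \<open>- y\<close>.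
\<close>

lemma robust_lmi:
  fixes YA :: "real ^ 'n ^ 'n" and YC :: "real ^ 'n ^ 'r" and Yw :: "real ^ ('k::finite \<times> 'n) ^ 'n"
  assumes e: "\<And>x. e * (x \<bullet> x) \<le> x \<bullet> (lmi_matrix YA YC Yw \<kappa>A \<kappa>w S Sb U Lb lam \<rho> *v x)" "0 \<le> e"
    and pos: "0 < \<kappa>A" "0 < \<kappa>w" "0 < lam" "0 < \<rho>"
    and dA: "mat_norm (vstack A C - vstack YA YC) \<le> \<kappa>A"
    and dw: "mat_norm (W - Yw) \<le> \<kappa>w"
  shows "e * (v \<bullet> v) \<le> 2 * (y \<bullet> (U *v y)) + 2 * (y \<bullet> ((U ** A + Lb ** C) *v v)) + v \<bullet> (Sb *v v)
           + 2 * (y \<bullet> (W *v (block_diag S *v u))) + u \<bullet> (block_diag S *v u)"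
proof -
  define d where "d = vjoin (A *v v) (C *v v) - vjoin (YA *v v) (YC *v v)"
  define f where "f = transpose (W - Yw) *v y"
  define x4 where "x4 = (1 / \<kappa>A) *\<^sub>R d"
  define x5 where "x5 = (1 / \<kappa>w) *\<^sub>R f"
  have "norm d \<le> \<kappa>A * norm v"
    using mat_norm_bound[OF dA, of v]
    by (simp add: d_def matrix_vector_mult_diff_rdistrib vstack_mult)
  then have x4: "x4 \<bullet> x4 \<le> v \<bullet> v"
    unfolding x4_def using pos(1) by (rule inner_scaled_le)
  have "norm f \<le> \<kappa>w * norm y"
    unfolding f_def by (rule mat_norm_bound_transpose[OF dw])
  then have x5: "x5 \<bullet> x5 \<le> y \<bullet> y"
    unfolding x5_def using pos(2) by (rule inner_scaled_le)
  have d': "d = vjoin (A *v v - YA *v v) (C *v v - YC *v v)"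
    by (auto simp: d_def vjoin_def vec_eq_iff split: sum.split)
  have 1: "\<kappa>A * (y \<bullet> ((U \<^bold>| Lb) *v x4)) =
      y \<bullet> ((U ** A + Lb ** C) *v v) - y \<bullet> ((U ** YA + Lb ** YC) *v v)"
    using pos
    by (simp add: x4_def matrix_vector_mult_scaleR d' hstack_vjoin matrix_vector_mult_diff_distrib
        matrix_vector_mult_add_rdistrib inner_right_distrib inner_diff_right
        flip: matrix_vector_mul_assoc)
  have "\<kappa>w * (x5 \<bullet> (block_diag S *v u)) = f \<bullet> (block_diag S *v u)"
    using pos by (simp add: x5_def)
  also have "\<dots> = y \<bullet> (W *v (block_diag S *v u)) - y \<bullet> (Yw *v (block_diag S *v u))"
    by (simp add: f_def dot_lmul_matrix matrix_vector_mult_diff_rdistrib inner_diff_right)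
  finally have 2: "\<kappa>w * (x5 \<bullet> (block_diag S *v u))
      = y \<bullet> (W *v (block_diag S *v u)) - y \<bullet> (Yw *v (block_diag S *v u))" .
  define x where "x = vjoin y (vjoin (- v) (vjoin v (vjoin x4 (vjoin x5 (vjoin u (- y))))))"
  have "v \<bullet> v \<le> x \<bullet> x"
    by (simp add: x_def inner_vjoin)
  then have "e * (v \<bullet> v) \<le> e * (x \<bullet> x)"
    using e(2) by (rule mult_left_mono)
  also have "\<dots> \<le> x \<bullet> (lmi_matrix YA YC Yw \<kappa>A \<kappa>w S Sb U Lb lam \<rho> *v x)"
    by (rule e(1))
  also have "\<dots> = 2 * (y \<bullet> (U *v y)) + 2 * (y \<bullet> ((U ** A + Lb ** C) *v v)) + v \<bullet> (Sb *v v)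
           + 2 * (y \<bullet> (W *v (block_diag S *v u))) + u \<bullet> (block_diag S *v u)
           + lam * (x4 \<bullet> x4 - v \<bullet> v) + \<rho> * (x5 \<bullet> x5 - y \<bullet> y)"
    unfolding x_def lmi_matrix_quadratic using 1 2 by (simp add: algebra_simps)
  also have "lam * (x4 \<bullet> x4 - v \<bullet> v) \<le> 0"
    using x4 pos by (simp add: mult_le_0_iff)
  also have "\<rho> * (x5 \<bullet> x5 - y \<bullet> y) \<le> 0"
    using x5 pos by (simp add: mult_le_0_iff)
  finally show ?thesis by simp
qed

text \<open>
  The upper left block \<open>U + U\<^sup>T\<close> is positive definite, so the kernel of \<open>U\<close> is trivial.
\<close>

lemma lmi_U_invertible:
  fixes YA :: "real ^ 'n ^ 'n" and YC :: "real ^ 'n ^ 'r" and Yw :: "real ^ ('k::finite \<times> 'n) ^ 'n"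
  assumes "pos_def (lmi_matrix YA YC Yw \<kappa>A \<kappa>w S Sb U Lb lam \<rho>)"
  shows "invertible U"
proof -
  have "y = 0" if "U *v y = 0" for y
  proof (rule ccontr)
    define x :: "real ^ ('n + 'n + 'n + ('n + 'r) + ('k \<times> 'n) + ('k \<times> 'n) + 'n)" where
      "x = vjoin y (vjoin 0 (vjoin 0 (vjoin 0 (vjoin 0 (vjoin 0 0)))))"
    assume "y \<noteq> 0"
    then have "x \<bullet> x \<noteq> 0" by (simp add: x_def inner_vjoin)
    then have "0 < x \<bullet> (lmi_matrix YA YC Yw \<kappa>A \<kappa>w S Sb U Lb lam \<rho> *v x)"
      using assms by (auto simp: pos_def_def)
    also have "\<dots> = 0"
      unfolding x_def lmi_matrix_quadratic using that by simp
    finally show False by simp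
  qed
  then have "inj ((*v) U)"
    by (simp add: matrix_left_invertible_injective[symmetric] matrix_left_invertible_ker)
  then show ?thesis
    by (simp add: invertible_left_inverse matrix_left_invertible_injective)
qed

text \<open>
  With \<open>Q = \<Sum>\<^sub>j w j S j\<close> the conclusion reads
  \<open>a\<^sup>T Q a \<le> Sb - e I\<close>. In the robust inequality the choice \<open>u = - W\<^sup>T y\<close> produces
  \<open>- y \<bullet> Q y\<close>. Since \<open>U A + Lb C = U a\<close>, what remains depends on \<open>U\<close> only through
  \<open>z = U\<^sup>T y\<close>, and it equals \<open>2 z \<bullet> (y + a v) + v \<bullet> Sb v - y \<bullet> Q y\<close>. The choice
  \<open>z = - Q a v\<close>, possible because \<open>U\<close> is invertible, makes this
  \<open>v \<bullet> Sb v - (a v) \<bullet> Q (a v) - (y + a v) \<bullet> Q (y + a v)\<close>, and the last square can be dropped.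
\<close>

lemma closed_loop_decrease:
  fixes YA :: "real ^ 'n ^ 'n" and YC :: "real ^ 'n ^ 'r" and Yw :: "real ^ ('k::finite \<times> 'n) ^ 'n"
  assumes e: "\<And>x. e * (x \<bullet> x) \<le> x \<bullet> (lmi_matrix YA YC Yw \<kappa>A \<kappa>w S Sb U Lb lam \<rho> *v x)" "0 \<le> e"
    and pos: "0 < \<kappa>A" "0 < \<kappa>w" "0 < lam" "0 < \<rho>"
    and dA: "mat_norm (vstack A C - vstack YA YC) \<le> \<kappa>A"
    and dw: "mat_norm (sqrt_row w - Yw) \<le> \<kappa>w"
    and w: "\<And>j. 0 \<le> w j"
    and S: "\<And>j. pos_def (S j)"
    and U: "invertible U"
  defines "a \<equiv> A + (matrix_inv U ** Lb) ** C"
  shows "(\<Sum>j\<in>UNIV. w j * ((a *v v) \<bullet> (S j *v (a *v v)))) \<le> v \<bullet> (Sb *v v) - e * (v \<bullet> v)"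
proof -
  define Q where "Q = (\<Sum>j\<in>UNIV. w j *\<^sub>R S j)"
  define b where "b = a *v v"
  define z where "z = - (Q *v b)"
  define y where "y = transpose (matrix_inv U) *v z"
  define u where "u = - (transpose (sqrt_row w :: real ^ ('k \<times> 'n) ^ 'n) *v y)"
  have "U ** matrix_inv U = mat 1 \<and> matrix_inv U ** U = mat 1"
    using U unfolding invertible_def matrix_inv_def by (rule someI_ex)
  then have UU: "matrix_inv U ** U = mat 1" "U ** matrix_inv U = mat 1"
    by simp_all
  have Qapp: "p \<bullet> (Q *v q) = (\<Sum>j\<in>UNIV. w j * (p \<bullet> (S j *v q)))" for p q
  proof -
    have "Q *v q = (\<Sum>j\<in>UNIV. w j *\<^sub>R (S j *v q))"
      by (simp add: Q_def vec_eq_iff matrix_vector_mult_def sum_distrib_left sum_distrib_right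
          sum.swap[of _ "UNIV::'k set"] ac_simps)
    then show ?thesis by (simp add: inner_sum_right)
  qed
  have Qsym: "p \<bullet> (Q *v q) = q \<bullet> (Q *v p)" for p q
  proof -
    have "p \<bullet> (S j *v q) = q \<bullet> (S j *v p)" for j
      using dot_matrix_transpose[of "S j" p q] S[of j] by (simp add: pos_def_def inner_commute del: transpose_matrix_vector)
    then show ?thesis by (simp add: Qapp)
  qed
  have Qnonneg: "0 \<le> p \<bullet> (Q *v p)" for p
  proof -
    have "0 \<le> p \<bullet> (S j *v p)" for j
      using S[of j] by (cases "p = 0") (auto simp: pos_def_def intro: less_imp_le)
    then show ?thesis by (simp add: Qapp sum_nonneg w)
  qed
  have yU: "y \<bullet> (U *v p) = z \<bullet> p" for p
    by (simp add: y_def dot_matrix_transpose matrix_vector_mul_assoc UU del: transpose_matrix_vector)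
  have "U ** A + Lb ** C = U ** a"
    by (simp add: a_def matrix_add_ldistrib matrix_mul_assoc UU)
  then have "e * (v \<bullet> v) \<le> 2 * (y \<bullet> (U *v y)) + 2 * (y \<bullet> (U *v b)) + v \<bullet> (Sb *v v)
           + 2 * (y \<bullet> (sqrt_row w *v (block_diag S *v u))) + u \<bullet> (block_diag S *v u)"
    using robust_lmi[OF e pos dA dw, of v y u] by (simp add: b_def matrix_vector_mul_assoc)
  moreover have "y \<bullet> (sqrt_row w *v (block_diag S *v u)) = - (u \<bullet> (block_diag S *v u))"
    by (simp add: u_def dot_matrix_transpose[symmetric] linear_neg[OF matrix_vector_mul_linear] del: transpose_matrix_vector)
  moreover have "u \<bullet> (block_diag S *v u) = y \<bullet> (Q *v y)"
    using sqrt_row_weighted_sum[OF w, where S = S and y = y] by (simp add: u_def Qapp linear_neg[OF matrix_vector_mul_linear] del: transpose_matrix_vector)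
  ultimately have "e * (v \<bullet> v) \<le> 2 * (z \<bullet> y) + 2 * (z \<bullet> b) + v \<bullet> (Sb *v v) - y \<bullet> (Q *v y)"
    by (simp add: yU)
  also have "z \<bullet> y = - (b \<bullet> (Q *v y))"
    using Qsym by (simp add: z_def inner_commute)
  also have "z \<bullet> b = - (b \<bullet> (Q *v b))"
    using Qsym by (simp add: z_def inner_commute)
  also have "2 * - (b \<bullet> (Q *v y)) + 2 * - (b \<bullet> (Q *v b)) + v \<bullet> (Sb *v v) - y \<bullet> (Q *v y)
      = v \<bullet> (Sb *v v) - b \<bullet> (Q *v b) - (y + b) \<bullet> (Q *v (y + b))"
    using Qsym[of y b] by (simp add: matrix_vector_right_distrib inner_left_distrib inner_right_distrib)
  also have "\<dots> \<le> v \<bullet> (Sb *v v) - b \<bullet> (Q *v b)"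
    using Qnonneg by simp
  finally show ?thesis by (simp add: Qapp b_def)
qed

section \<open>Complex matrices under real congruences\<close>

definition congruence :: "real ^ 'n ^ 'n \<Rightarrow> complex ^ 'n ^ 'n \<Rightarrow> complex ^ 'n ^ 'n" where
  "congruence A V = cmat A ** V ** transpose (cmat A)"

text \<open>The matrix \<open>u x y\<^sup>T\<close>.\<close>

definition rank1 :: "complex \<Rightarrow> real ^ 'n \<Rightarrow> real ^ 'n \<Rightarrow> complex ^ 'n ^ 'n" where
  "rank1 u x y = (\<chi> a b. u * complex_of_real (x $ a * y $ b))"

lemma cmat_transpose: "cmat (transpose A) = transpose (cmat A)"
  by (simp add: cmat_def transpose_def)

lemma inner_cmat_left: "(cmat A ** X) \<bullet> Y = X \<bullet> (transpose (cmat A) ** Y)"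
proof -
  have "(cmat A ** X) \<bullet> Y = (\<Sum>i\<in>UNIV. \<Sum>j\<in>UNIV. \<Sum>k\<in>UNIV. A $ i $ k * (X $ k $ j \<bullet> Y $ i $ j))"
    by (simp add: inner_vec_def matrix_matrix_mult_def cmat_def inner_sum_left
        flip: scaleR_conv_of_real)
  also have "\<dots> = (\<Sum>k\<in>UNIV. \<Sum>j\<in>UNIV. \<Sum>i\<in>UNIV. A $ i $ k * (X $ k $ j \<bullet> Y $ i $ j))"
    by (subst sum.swap, subst (2) sum.swap, subst sum.swap) (rule refl)
  also have "\<dots> = X \<bullet> (transpose (cmat A) ** Y)"
    by (simp add: inner_vec_def matrix_matrix_mult_def cmat_def inner_sum_right transpose_def
        flip: scaleR_conv_of_real)
  finally show ?thesis .
qed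

lemma inner_transpose: "transpose X \<bullet> transpose Y = X \<bullet> (Y :: complex ^ 'm ^ 'n)"
  by (simp add: inner_vec_def transpose_def) (rule sum.swap)

lemma inner_cmat_right: "(X ** transpose (cmat A)) \<bullet> Y = X \<bullet> (Y ** cmat A)"
proof -
  have "(X ** transpose (cmat A)) \<bullet> Y = (cmat A ** transpose X) \<bullet> transpose Y"
    by (metis inner_transpose matrix_transpose_mul transpose_transpose)
  also have "\<dots> = transpose X \<bullet> transpose (Y ** cmat A)"
    by (simp add: inner_cmat_left matrix_transpose_mul)
  finally show ?thesis by (simp add: inner_transpose)
qed

text \<open>
  The inner product is the real one, \<open>Re (tr (F\<^sup>* V))\<close>; with respect to it, congruence by a
  real matrix has congruence by the transpose as its adjoint.
\<close>

lemma congruence_adjoint: "congruence A V \<bullet> F = V \<bullet> congruence (transpose A) F"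
  by (simp add: congruence_def inner_cmat_left inner_cmat_right cmat_transpose matrix_mul_assoc)

text \<open>
  Together with the previous lemma: testing \<open>A\<^sup>T F A\<close> against \<open>u x y\<^sup>T\<close> amounts to
  testing \<open>F\<close> against \<open>u (A x) (A y)\<^sup>T\<close>. This is how the decrease of a real quadratic form
  along \<open>A\<close> acts on complex matrices.
\<close>

lemma congruence_rank1: "congruence A (rank1 u x y) = rank1 u (A *v x) (A *v y)"
proof -
  have "congruence A (rank1 u x y) $ i $ j = rank1 u (A *v x) (A *v y) $ i $ j" for i j
  proof -
    have "congruence A (rank1 u x y) $ i $ j
        = (\<Sum>b\<in>UNIV. \<Sum>a\<in>UNIV. u * complex_of_real ((A $ i $ a * x $ a) * (A $ j $ b * y $ b)))"
      by (simp add: congruence_def rank1_def cmat_def matrix_matrix_mult_def transpose_def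
          sum_distrib_left sum_distrib_right ac_simps)
    also have "\<dots> = u * complex_of_real ((\<Sum>a\<in>UNIV. A $ i $ a * x $ a) * (\<Sum>b\<in>UNIV. A $ j $ b * y $ b))"
      unfolding sum_product unfolding of_real_sum sum_distrib_left by (rule sum.swap)
    finally show ?thesis by (simp add: rank1_def matrix_vector_mult_def)
  qed
  then show ?thesis by (simp add: vec_eq_iff)
qed

lemma norm_rank1: "norm (rank1 u x y) = cmod u * norm x * norm y"
proof -
  have row: "norm (rank1 u x y $ a) = norm (cmod u * x $ a) * norm y" for a
    by (simp add: rank1_def norm_vec_def norm_mult abs_mult L2_set_right_distrib mult.assoc)
  have "norm (rank1 u x y) = L2_set (\<lambda>a. (cmod u * norm y) * norm (x $ a)) UNIV"
    unfolding norm_vec_def[of "rank1 u x y"] row by (simp add: abs_mult ac_simps)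
  also have "\<dots> = (cmod u * norm y) * norm x"
    unfolding norm_vec_def[of x] by (rule L2_set_right_distrib[symmetric]) simp
  finally show ?thesis by simp
qed

text \<open>
  Rank one matrices detect every entry, up to real and imaginary part.
\<close>

lemma Basis_rank1:
  assumes "b \<in> (Basis :: (complex ^ 'n ^ 'n) set)"
  obtains u i j where "cmod u = 1" "b = rank1 u (axis i 1) (axis j 1)"
proof -
  from assms obtain i j u where "b = axis i (axis j u)" "u \<in> Basis"
    by (auto simp: Basis_vec_def)
  moreover from this have "b = rank1 u (axis i 1) (axis j 1)"
    by (auto simp: rank1_def axis_def vec_eq_iff)
  ultimately show ?thesis using that[of u i j] by (auto simp: Basis_complex_def)
qed

lemma inner_cscale_left: "cscale z X \<bullet> Y = X \<bullet> cscale (cnj z) Y"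
  by (simp add: cscale_def inner_vec_def inner_complex_def algebra_simps)

lemma cscale_rank1: "cscale z (rank1 u x y) = rank1 (z * u) x y"
  by (simp add: cscale_def rank1_def mult.assoc)

lemma cscale_cscale: "cscale a (cscale b X) = cscale (a * b) X"
  by (simp add: cscale_def mult.assoc)

lemma cscale_of_real: "cscale (complex_of_real t) X = t *\<^sub>R X"
  by (simp add: cscale_def vec_eq_iff) (simp add: scaleR_conv_of_real)

lemma norm_cscale: "norm (cscale z X) = cmod z * norm X"
proof -
  have row: "norm (cscale z X $ a) = cmod z * norm (X $ a)" for a
    by (simp add: cscale_def norm_vec_def norm_mult L2_set_right_distrib)
  show ?thesis
    by (simp only: norm_vec_def[of "cscale z X"] norm_vec_def[of X] row L2_set_right_distrib norm_ge_zero)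
qed

lemma bounded_linear_cscale:
  "bounded_linear (cscale z :: complex ^ 'm ^ 'n \<Rightarrow> complex ^ 'm ^ 'n)"
proof (rule bounded_linear_intro[where K = "cmod z"])
  show "norm (cscale z X) \<le> norm X * cmod z" for X :: "complex ^ 'm ^ 'n"
    by (simp add: norm_cscale)
qed (simp_all add: cscale_def vec_eq_iff algebra_simps)

lemma norm_matrix_mult_entry:
  fixes X Y :: "complex ^ 'n ^ 'n"
  assumes "\<And>i j. cmod (X $ i $ j) \<le> a" "\<And>i j. cmod (Y $ i $ j) \<le> b"
  shows "cmod ((X ** Y) $ i $ j) \<le> real CARD('n) * a * b"
proof -
  have "0 \<le> a" using assms(1) norm_ge_zero order_trans by blast
  have "cmod ((X ** Y) $ i $ j) \<le> (\<Sum>k\<in>(UNIV::'n set). a * b)"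
    unfolding matrix_matrix_mult_def vec_lambda_beta
  proof (rule sum_norm_le)
    show "cmod (X $ i $ k * Y $ k $ j) \<le> a * b" for k
      using assms \<open>0 \<le> a\<close> by (simp add: norm_mult mult_mono)
  qed
  then show ?thesis by simp
qed

lemma norm_congruence_le:
  fixes A :: "real ^ 'n ^ 'n"
  assumes "\<And>i j. \<bar>A $ i $ j\<bar> \<le> c"
  shows "norm (congruence A V) \<le> real CARD('n) ^ 4 * c\<^sup>2 * norm V"
proof -
  let ?N = "real CARD('n)"
  have V: "cmod (V $ i $ j) \<le> norm V" for i j
    by (rule order_trans[OF Finite_Cartesian_Product.norm_nth_le Finite_Cartesian_Product.norm_nth_le])
  have A: "cmod (cmat A $ i $ j) \<le> c" "cmod (transpose (cmat A) $ i $ j) \<le> c" for i j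
    using assms by (simp_all add: cmat_def transpose_def)
  \<comment> \<open>Two matrix products, each entry a sum of \<open>n\<close> terms.\<close>
  have e: "cmod (congruence A V $ i $ j) \<le> ?N * (?N * c * norm V) * c" for i j
    unfolding congruence_def by (intro norm_matrix_mult_entry A V)
  have "norm (congruence A V) \<le> (\<Sum>i\<in>UNIV. norm (congruence A V $ i))"
    unfolding norm_vec_def[of "congruence A V"] by (rule L2_set_le_sum) simp
  also have "\<dots> \<le> (\<Sum>i\<in>UNIV. \<Sum>j\<in>UNIV. cmod (congruence A V $ i $ j))"
    unfolding norm_vec_def[of "congruence A V $ _"] by (intro sum_mono L2_set_le_sum) simp
  also have "\<dots> \<le> (\<Sum>i\<in>(UNIV::'n set). \<Sum>j\<in>(UNIV::'n set). ?N * (?N * c * norm V) * c)"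
    by (intro sum_mono e)
  also have "\<dots> = ?N ^ 4 * c\<^sup>2 * norm V"
    by (simp add: power2_eq_square power4_eq_xxxx)
  finally show ?thesis .
qed

lemma borel_measurable_congruence:
  assumes "A \<in> borel_measurable M" "V \<in> borel_measurable M"
  shows "(\<lambda>x. congruence (A x) (V x)) \<in> borel_measurable M"
proof (rule borel_measurable_continuous_Pair[OF assms])
  show "continuous_on UNIV (\<lambda>p. congruence (fst p) (snd p) :: complex ^ 'c ^ 'c)"
    unfolding congruence_def cmat_def matrix_matrix_mult_def transpose_def
    by (intro continuous_intros)
qed

section \<open>Lyapunov functions bound the spectral radius\<close>

lemma spec_radius_leI:
  assumes "\<And>z. r < cmod z \<Longrightarrow> z \<in> resolvent_set \<mu> T"
  shows "spec_radius \<mu> T \<le> ennreal r"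
  unfolding spec_radius_def spectrum_set_def
proof (rule SUP_least)
  fix z assume "z \<in> - resolvent_set \<mu> T"
  then have "cmod z \<le> r" using assms[of z] by fastforce
  then show "ennreal (cmod z) \<le> ennreal r" by (rule ennreal_leI)
qed

lemma transition_density_row:
  assumes g: "transition_density \<mu> g" and l: "l \<in> space \<mu>"
  shows "g l \<in> borel_measurable \<mu>" "integrable \<mu> (g l)" "(LINT \<phi>|\<mu>. g l \<phi>) = 1"
proof -
  interpret P: prob_space "density \<mu> (\<lambda>\<phi>. ennreal (g l \<phi>))"
    using g l by (simp add: transition_density_def)
  show meas: "g l \<in> borel_measurable \<mu>"
    using g measurable_Pair2[of "\<lambda>(\<phi>, l). g \<phi> l" \<mu> \<mu> borel l] l by (simp add: transition_density_def)
  have nn: "AE \<phi> in \<mu>. 0 \<le> g l \<phi>"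
    using g l by (auto simp: transition_density_def)
  have "integrable (density \<mu> (\<lambda>\<phi>. ennreal (g l \<phi>))) (\<lambda>_. 1::real)"
    by simp
  then show "integrable \<mu> (g l)"
    using nn meas by (subst (asm) integrable_density) auto
  have "(LINT \<phi>|density \<mu> (\<lambda>\<phi>. ennreal (g l \<phi>)). 1::real) = 1"
    using P.prob_space by simp
  then show "(LINT \<phi>|\<mu>. g l \<phi>) = 1"
    using nn meas by (subst (asm) integral_density) auto
qed

text \<open>
  The last assumption says that \<open>x \<bullet> S \<phi> x\<close> is a Lyapunov function of the linear system with
  Markov jumps: if the mode is \<open>l\<close>, its expected value after one step is at most \<open>r\<close> times
  its present value. The bounds \<open>\<alpha>\<close> and \<open>\<beta>\<close> make it comparable with \<open>|x|\<^sup>2\<close>, uniformly in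
  the mode.
\<close>

locale lyapunov_function = sigma_finite_measure \<mu> for \<mu> :: "'a measure" +
  fixes g :: "'a \<Rightarrow> 'a \<Rightarrow> real"
    and A S :: "'a \<Rightarrow> real ^ 'n ^ 'n"
    and \<alpha> \<beta> r :: real
  assumes density: "transition_density \<mu> g"
    and A_bdd: "A \<in> H_sup \<mu>"
    and S_meas: "S \<in> borel_measurable \<mu>"
    and \<alpha>_pos: "0 < \<alpha>"
    and r_pos: "0 < r"
    and S_lower: "\<And>\<phi> x. \<phi> \<in> space \<mu> \<Longrightarrow> \<alpha> * (x \<bullet> x) \<le> x \<bullet> (S \<phi> *v x)"
    and S_upper: "\<And>\<phi> x. \<phi> \<in> space \<mu> \<Longrightarrow> x \<bullet> (S \<phi> *v x) \<le> \<beta> * (x \<bullet> x)"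
    and decrease: "AE l in \<mu>. \<forall>x.
       (LINT \<phi>|\<mu>. g l \<phi> * ((A l *v x) \<bullet> (S \<phi> *v (A l *v x)))) \<le> r * (x \<bullet> (S l *v x))"
begin

abbreviation "T \<equiv> L_op \<mu> g A"

abbreviation "S_form \<phi> x \<equiv> x \<bullet> (S \<phi> *v x)"

lemma A_meas [measurable]: "A \<in> borel_measurable \<mu>"
  using A_bdd by (simp add: H_sup_def)

lemma g_meas [measurable]: "(\<lambda>(\<phi>, l). g \<phi> l) \<in> borel_measurable (\<mu> \<Otimes>\<^sub>M \<mu>)"
  using density by (simp add: transition_density_def)

lemma g_nonneg: "\<phi> \<in> space \<mu> \<Longrightarrow> l \<in> space \<mu> \<Longrightarrow> 0 \<le> g \<phi> l"
  using density by (simp add: transition_density_def)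

lemmas g_row_meas = transition_density_row(1)[OF density]
  and g_row = transition_density_row(2,3)[OF density]

lemma pair_sigma_finite_self: "pair_sigma_finite \<mu> \<mu>"
  by (intro pair_sigma_finite.intro sigma_finite_measure_axioms)

text \<open>The fields that pair with integrable ones.\<close>

definition bounded_field :: "('a \<Rightarrow> complex ^ 'n ^ 'n) \<Rightarrow> bool" where
  "bounded_field F \<longleftrightarrow> F \<in> borel_measurable \<mu> \<and> (\<exists>c\<ge>0. AE \<phi> in \<mu>. norm (F \<phi>) \<le> c)"

lemma integrable_pairing:
  assumes "bounded_field F" "V \<in> H1 \<mu>"
  shows "integrable \<mu> (\<lambda>\<phi>. F \<phi> \<bullet> V \<phi>)"
proof -
  from assms obtain c where [measurable]: "F \<in> borel_measurable \<mu>" and V [measurable]: "integrable \<mu> V"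
    and c: "0 \<le> c" "AE \<phi> in \<mu>. norm (F \<phi>) \<le> c"
    by (auto simp: bounded_field_def H1_def)
  have le: "AE \<phi> in \<mu>. norm (F \<phi> \<bullet> V \<phi>) \<le> norm (c * norm (V \<phi>))"
    using c(2)
  proof eventually_elim
    case (elim \<phi>)
    have "\<bar>F \<phi> \<bullet> V \<phi>\<bar> \<le> norm (F \<phi>) * norm (V \<phi>)" by (rule Cauchy_Schwarz_ineq2)
    also have "\<dots> \<le> c * norm (V \<phi>)" using elim by (intro mult_right_mono) auto
    finally show ?case using c(1) by simp
  qed
  have meas: "(\<lambda>\<phi>. F \<phi> \<bullet> V \<phi>) \<in> borel_measurable \<mu>" by measurable
  show ?thesis
    by (rule Bochner_Integration.integrable_bound[OF _ meas le]) (intro integrable_mult_right integrable_norm V)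
qed

lemma congruence_H1:
  assumes "V \<in> H1 \<mu>"
  shows "(\<lambda>l. congruence (A l) (V l)) \<in> H1 \<mu>"
proof -
  from A_bdd obtain c where c: "AE l in \<mu>. mat_norm (A l) \<le> c" by (auto simp: H_sup_def)
  have V [measurable]: "integrable \<mu> V" using assms by (simp add: H1_def)
  let ?K = "real CARD('n) ^ 4 * c\<^sup>2"
  have le: "AE l in \<mu>. norm (congruence (A l) (V l)) \<le> norm (?K * norm (V l))"
    using c
  proof eventually_elim
    case (elim l)
    have "\<bar>A l $ i $ j\<bar> \<le> c" for i j
      using matrix_component_le_onorm[of "A l" i j] elim by (simp add: mat_norm_def)
    from norm_congruence_le[OF this] show ?case by simp
  qed
  have meas: "(\<lambda>l. congruence (A l) (V l)) \<in> borel_measurable \<mu>"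
    by (rule borel_measurable_congruence) measurable
  have "integrable \<mu> (\<lambda>l. congruence (A l) (V l))"
    by (rule Bochner_Integration.integrable_bound[OF _ meas le]) (intro integrable_mult_right integrable_norm V)
  then show ?thesis by (simp add: H1_def)
qed

lemma T_eq: "T V \<phi> = (LINT l|\<mu>. g l \<phi> *\<^sub>R congruence (A l) (V l))"
  by (simp add: L_op_def congruence_def)

text \<open>
  Every row of the kernel has total mass one, so that a bound of \<open>H l\<close> by \<open>h l\<close> is inherited by
  the row integral. All applications of Fubini's theorem below rest on this lemma.
\<close>

lemma kernel_integrable:
  fixes H :: "'a \<Rightarrow> 'a \<Rightarrow> 'b::{banach, second_countable_topology}"
  assumes H [measurable]: "case_prod H \<in> borel_measurable (\<mu> \<Otimes>\<^sub>M \<mu>)"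
    and h: "integrable \<mu> h" "\<And>l. 0 \<le> h l"
    and le: "\<And>l. l \<in> space \<mu> \<Longrightarrow> AE \<phi> in \<mu>. norm (H l \<phi>) \<le> h l"
  shows "integrable (\<mu> \<Otimes>\<^sub>M \<mu>) (\<lambda>(l, \<phi>). g l \<phi> *\<^sub>R H l \<phi>)"
proof -
  interpret pair_sigma_finite \<mu> \<mu> by (rule pair_sigma_finite_self)
  have H_row: "H l \<in> borel_measurable \<mu>" if "l \<in> space \<mu>" for l
    using measurable_Pair2[OF H that] by simp
  have bound: "AE \<phi> in \<mu>. norm (g l \<phi> *\<^sub>R H l \<phi>) \<le> norm (h l * g l \<phi>)" if l: "l \<in> space \<mu>" for l
    using le[OF l] AE_space
  proof eventually_elim
    case (elim \<phi>)
    then show ?case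
      using g_nonneg[OF l, of \<phi>] h(2)[of l] mult_left_mono[of "norm (H l \<phi>)" "h l" "g l \<phi>"]
      by (simp add: mult.commute)
  qed
  have row: "integrable \<mu> (\<lambda>\<phi>. g l \<phi> *\<^sub>R H l \<phi>)" if l: "l \<in> space \<mu>" for l
    using integrable_mult_right[OF g_row(1)[OF l]] borel_measurable_scaleR[OF g_row_meas[OF l] H_row[OF l]]
      bound[OF l] by (rule Bochner_Integration.integrable_bound)
  have row_le: "(LINT \<phi>|\<mu>. norm (g l \<phi> *\<^sub>R H l \<phi>)) \<le> h l" if l: "l \<in> space \<mu>" for l
  proof -
    have "(LINT \<phi>|\<mu>. norm (g l \<phi> *\<^sub>R H l \<phi>)) \<le> (LINT \<phi>|\<mu>. norm (h l * g l \<phi>))"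
      using integrable_norm[OF row[OF l]] integrable_norm[OF integrable_mult_right[OF g_row(1)[OF l]]]
        bound[OF l] by (rule integral_mono_AE)
    also have "\<dots> = (LINT \<phi>|\<mu>. h l * g l \<phi>)"
      using h(2)[of l] g_nonneg[OF l] by (intro Bochner_Integration.integral_cong) auto
    also have "\<dots> = h l" using g_row(2)[OF l] by simp
    finally show ?thesis .
  qed
  show ?thesis
  proof (rule Fubini_integrable)
    show "integrable \<mu> (\<lambda>l. LINT \<phi>|\<mu>. norm (case (l, \<phi>) of (l, \<phi>) \<Rightarrow> g l \<phi> *\<^sub>R H l \<phi>))"
    proof (rule Bochner_Integration.integrable_bound[OF h(1)])
      show "AE l in \<mu>. norm (LINT \<phi>|\<mu>. norm (case (l, \<phi>) of (l, \<phi>) \<Rightarrow> g l \<phi> *\<^sub>R H l \<phi>)) \<le> norm (h l)"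
        using row_le h(2) by (intro AE_I2) (auto simp: abs_le_iff intro!: integral_nonneg)
    qed measurable
    show "AE l in \<mu>. integrable \<mu> (\<lambda>\<phi>. case (l, \<phi>) of (l, \<phi>) \<Rightarrow> g l \<phi> *\<^sub>R H l \<phi>)"
      using row by (intro AE_I2) simp
  qed measurable
qed

lemma T_H1:
  assumes "V \<in> H1 \<mu>"
  shows "T V \<in> H1 \<mu>"
proof -
  interpret pair_sigma_finite \<mu> \<mu> by (rule pair_sigma_finite_self)
  have Z: "integrable \<mu> (\<lambda>l. congruence (A l) (V l))"
    using congruence_H1[OF assms] by (simp add: H1_def)
  note [measurable] = borel_measurable_integrable[OF Z]
  have "integrable (\<mu> \<Otimes>\<^sub>M \<mu>) (\<lambda>(l, \<phi>). g l \<phi> *\<^sub>R congruence (A l) (V l))"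
    by (rule kernel_integrable[where h = "\<lambda>l. norm (congruence (A l) (V l))"]) (use Z in auto)
  from integrable_snd[OF this] show ?thesis by (simp add: H1_def T_eq[abs_def])
qed

text \<open>The operator adjoint to \<open>T\<close>; it averages over the next mode, that is, over the second argument of \<open>g\<close>.\<close>

definition adjoint :: "('a \<Rightarrow> complex ^ 'n ^ 'n) \<Rightarrow> 'a \<Rightarrow> complex ^ 'n ^ 'n" where
  "adjoint F l = congruence (transpose (A l)) (LINT \<phi>|\<mu>. g l \<phi> *\<^sub>R F \<phi>)"

lemma kernel_field_integrable:
  assumes "bounded_field F" "l \<in> space \<mu>"
  shows "integrable \<mu> (\<lambda>\<phi>. g l \<phi> *\<^sub>R F \<phi>)"
proof -
  from assms obtain c where [measurable]: "F \<in> borel_measurable \<mu>"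
    and c: "0 \<le> c" "AE \<phi> in \<mu>. norm (F \<phi>) \<le> c"
    by (auto simp: bounded_field_def)
  have le: "AE \<phi> in \<mu>. norm (g l \<phi> *\<^sub>R F \<phi>) \<le> norm (c * g l \<phi>)"
    using c(2) AE_space
  proof eventually_elim
    case (elim \<phi>)
    then show ?case
      using g_nonneg[OF assms(2), of \<phi>] c(1) mult_left_mono[of "norm (F \<phi>)" c "g l \<phi>"]
      by (simp add: mult.commute)
  qed
  have meas: "(\<lambda>\<phi>. g l \<phi> *\<^sub>R F \<phi>) \<in> borel_measurable \<mu>"
    by (intro borel_measurable_scaleR g_row_meas assms(2)) measurable
  show ?thesis
    by (rule Bochner_Integration.integrable_bound[OF _ meas le])
      (intro integrable_mult_right g_row(1) assms(2))
qed

lemma adjoint_pairing: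
  assumes F: "bounded_field F" and V: "V \<in> H1 \<mu>"
  shows "(LINT \<phi>|\<mu>. F \<phi> \<bullet> T V \<phi>) = (LINT l|\<mu>. adjoint F l \<bullet> V l)"
proof -
  interpret pair_sigma_finite \<mu> \<mu> by (rule pair_sigma_finite_self)
  from F obtain c where [measurable]: "F \<in> borel_measurable \<mu>"
    and c: "0 \<le> c" "AE \<phi> in \<mu>. norm (F \<phi>) \<le> c"
    by (auto simp: bounded_field_def)
  define Z where "Z l = congruence (A l) (V l)" for l
  have Z: "integrable \<mu> Z"
    using congruence_H1[OF V] unfolding H1_def Z_def[abs_def] by simp
  note [measurable] = borel_measurable_integrable[OF Z]
  have "AE \<phi> in \<mu>. integrable \<mu> (\<lambda>l. g l \<phi> *\<^sub>R Z l)"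
  proof (rule AE_integrable_snd)
    show "integrable (\<mu> \<Otimes>\<^sub>M \<mu>) (\<lambda>(l, \<phi>). g l \<phi> *\<^sub>R Z l)"
    proof (rule kernel_integrable)
      show "integrable \<mu> (\<lambda>l. norm (Z l))" using Z by (rule integrable_norm)
      show "case_prod (\<lambda>l \<phi>. Z l) \<in> borel_measurable (\<mu> \<Otimes>\<^sub>M \<mu>)" by measurable
    qed simp_all
  qed
  then have 1: "AE \<phi> in \<mu>. F \<phi> \<bullet> T V \<phi> = (LINT l|\<mu>. g l \<phi> *\<^sub>R (F \<phi> \<bullet> Z l))"
  proof eventually_elim
    case (elim \<phi>)
    have "F \<phi> \<bullet> T V \<phi> = (LINT l|\<mu>. F \<phi> \<bullet> (g l \<phi> *\<^sub>R Z l))"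
      unfolding T_eq Z_def[symmetric] using elim by (intro integral_inner_right[symmetric])
    then show ?case by simp
  qed
  have int: "integrable (\<mu> \<Otimes>\<^sub>M \<mu>) (\<lambda>(l, \<phi>). g l \<phi> *\<^sub>R (F \<phi> \<bullet> Z l))"
  proof (rule kernel_integrable)
    show "integrable \<mu> (\<lambda>l. c * norm (Z l))"
      by (intro integrable_mult_right integrable_norm Z)
    show "0 \<le> c * norm (Z l)" for l using c(1) by simp
    show "case_prod (\<lambda>l \<phi>. F \<phi> \<bullet> Z l) \<in> borel_measurable (\<mu> \<Otimes>\<^sub>M \<mu>)" by measurable
    fix l
    show "AE \<phi> in \<mu>. norm (F \<phi> \<bullet> Z l) \<le> c * norm (Z l)"
      using c(2)
    proof eventually_elim
      case (elim \<phi>)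
      have "\<bar>F \<phi> \<bullet> Z l\<bar> \<le> norm (F \<phi>) * norm (Z l)" by (rule Cauchy_Schwarz_ineq2)
      also have "\<dots> \<le> c * norm (Z l)" using elim by (intro mult_right_mono) auto
      finally show ?case by simp
    qed
  qed
  have "(LINT \<phi>|\<mu>. F \<phi> \<bullet> T V \<phi>) = (LINT \<phi>|\<mu>. LINT l|\<mu>. g l \<phi> *\<^sub>R (F \<phi> \<bullet> Z l))"
  proof (rule integral_cong_AE)
    show "(\<lambda>\<phi>. F \<phi> \<bullet> T V \<phi>) \<in> borel_measurable \<mu>"
      using integrable_pairing[OF F T_H1[OF V]] by simp
    show "(\<lambda>\<phi>. LINT l|\<mu>. g l \<phi> *\<^sub>R (F \<phi> \<bullet> Z l)) \<in> borel_measurable \<mu>"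
      using integrable_snd[OF int] by simp
  qed (rule 1)
  also have "\<dots> = (LINT l|\<mu>. LINT \<phi>|\<mu>. g l \<phi> *\<^sub>R (F \<phi> \<bullet> Z l))"
    by (rule Fubini_integral[OF int])
  also have "\<dots> = (LINT l|\<mu>. adjoint F l \<bullet> V l)"
  proof (rule Bochner_Integration.integral_cong[OF refl])
    fix l assume l: "l \<in> space \<mu>"
    have "(LINT \<phi>|\<mu>. g l \<phi> *\<^sub>R (F \<phi> \<bullet> Z l)) = (LINT \<phi>|\<mu>. (g l \<phi> *\<^sub>R F \<phi>) \<bullet> Z l)"
      by simp
    also have "\<dots> = (LINT \<phi>|\<mu>. g l \<phi> *\<^sub>R F \<phi>) \<bullet> Z l"
      using kernel_field_integrable[OF F l] by (rule integral_inner_left)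
    also have "\<dots> = adjoint F l \<bullet> V l"
      unfolding Z_def adjoint_def
      by (subst inner_commute, subst congruence_adjoint) (rule inner_commute)
    finally show "(LINT \<phi>|\<mu>. g l \<phi> *\<^sub>R (F \<phi> \<bullet> Z l)) = adjoint F l \<bullet> V l" .
  qed
  finally show ?thesis .
qed

text \<open>
  The unit ball of a dual norm. For a Hermitian positive semidefinite \<open>V\<close> the natural functional is
  the integral of \<open>tr (S V)\<close>, which \<open>T\<close> contracts by the factor \<open>r\<close>. A norm for all complex
  fields arises by letting every field \<open>F\<close> compete that is dominated by \<open>S\<close> in the sense
  \<open>2 |x\<^sup>T F y| \<le> x\<^sup>T S x + y\<^sup>T S y\<close> for real \<open>x\<close> and \<open>y\<close>. This form is linear in \<open>F\<close>
  and \<open>S\<close>, hence stable under averaging and under real congruences, which are the two ingredients of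
  the adjoint of \<open>T\<close>. The factor \<open>u\<close> replaces the modulus.
\<close>

definition dominated :: "('a \<Rightarrow> complex ^ 'n ^ 'n) \<Rightarrow> bool" where
  "dominated F \<longleftrightarrow> F \<in> borel_measurable \<mu> \<and>
     (AE \<phi> in \<mu>. \<forall>u x y. cmod u = 1 \<longrightarrow> 2 * (F \<phi> \<bullet> rank1 u x y) \<le> S_form \<phi> x + S_form \<phi> y)"

definition dual_norm :: "('a \<Rightarrow> complex ^ 'n ^ 'n) \<Rightarrow> real" where
  "dual_norm V = (SUP F\<in>Collect dominated. \<bar>LINT \<phi>|\<mu>. F \<phi> \<bullet> V \<phi>\<bar>)"

definition dom_bound :: real where "dom_bound = real DIM(complex ^ 'n ^ 'n) * \<bar>\<beta>\<bar>"

lemma dom_bound_nonneg: "0 \<le> dom_bound" by (simp add: dom_bound_def)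

lemma S_form_nonneg: "\<phi> \<in> space \<mu> \<Longrightarrow> 0 \<le> S_form \<phi> x"
  using S_lower[of \<phi> x] \<alpha>_pos by (meson inner_ge_zero less_imp_le mult_nonneg_nonneg order_trans)

text \<open>
  Up to sign, every coordinate is one of the tests in the definition of domination, with unit vectors
  \<open>x\<close> and \<open>y\<close>, at which the form of \<open>S\<close> is at most \<open>\<beta>\<close>.
\<close>

lemma dominated_norm_le:
  assumes "dominated F"
  shows "AE \<phi> in \<mu>. norm (F \<phi>) \<le> dom_bound"
proof -
  have "AE \<phi> in \<mu>. \<forall>u x y. cmod u = 1 \<longrightarrow> 2 * (F \<phi> \<bullet> rank1 u x y) \<le> S_form \<phi> x + S_form \<phi> y"
    using assms by (simp add: dominated_def)
  then show ?thesis
    using AE_space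
  proof eventually_elim
    case (elim \<phi>)
    have le: "F \<phi> \<bullet> rank1 u (axis i 1) (axis j 1) \<le> \<bar>\<beta>\<bar>" if "cmod u = 1" for u i j
    proof -
      have "S_form \<phi> (axis k 1) \<le> \<bar>\<beta>\<bar>" for k
        using S_upper[OF elim(2), of "axis k 1"] by (simp add: inner_axis_axis)
      then have "S_form \<phi> (axis i 1) + S_form \<phi> (axis j 1) \<le> \<bar>\<beta>\<bar> + \<bar>\<beta>\<bar>" by (intro add_mono)
      then show ?thesis using elim(1)[rule_format, OF that, of "axis i 1" "axis j 1"] by simp
    qed
    have "\<bar>F \<phi> \<bullet> b\<bar> \<le> \<bar>\<beta>\<bar>" if bB: "b \<in> Basis" for b
    proof -
      obtain u i j where u: "cmod u = 1" and b: "b = rank1 u (axis i 1) (axis j 1)"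
        using Basis_rank1[OF bB] .
      have "- b = rank1 (- u) (axis i 1) (axis j 1)"
        by (simp add: b rank1_def vec_eq_iff)
      then have "F \<phi> \<bullet> (- b) \<le> \<bar>\<beta>\<bar>" using le[of "- u"] u by simp
      moreover have "F \<phi> \<bullet> b \<le> \<bar>\<beta>\<bar>" using le u b by simp
      ultimately show ?thesis by simp
    qed
    then have "(\<Sum>b\<in>Basis. \<bar>F \<phi> \<bullet> b\<bar>) \<le> dom_bound"
      unfolding dom_bound_def using sum_bounded_above[of Basis "\<lambda>b. \<bar>F \<phi> \<bullet> b\<bar>" "\<bar>\<beta>\<bar>"] by simp
    then show ?case using norm_le_l1[of "F \<phi>"] by linarith
  qed
qed

lemma dominated_bounded_field: "dominated F \<Longrightarrow> bounded_field F"
  using dominated_norm_le dom_bound_nonneg by (auto simp: bounded_field_def dominated_def)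

lemma pairing_le:
  assumes "dominated F" "V \<in> H1 \<mu>"
  shows "\<bar>LINT \<phi>|\<mu>. F \<phi> \<bullet> V \<phi>\<bar> \<le> dom_bound * H1_norm \<mu> V"
proof -
  have V: "integrable \<mu> V" using assms(2) by (simp add: H1_def)
  have int: "integrable \<mu> (\<lambda>\<phi>. F \<phi> \<bullet> V \<phi>)"
    by (intro integrable_pairing dominated_bounded_field assms)
  have "\<bar>LINT \<phi>|\<mu>. F \<phi> \<bullet> V \<phi>\<bar> \<le> (LINT \<phi>|\<mu>. norm (F \<phi> \<bullet> V \<phi>))"
    using integral_norm_bound[of \<mu> "\<lambda>\<phi>. F \<phi> \<bullet> V \<phi>"] by simp
  also have "\<dots> \<le> (LINT \<phi>|\<mu>. dom_bound * norm (V \<phi>))"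
  proof (rule integral_mono_AE)
    show "AE \<phi> in \<mu>. norm (F \<phi> \<bullet> V \<phi>) \<le> dom_bound * norm (V \<phi>)"
      using dominated_norm_le[OF assms(1)]
    proof eventually_elim
      case (elim \<phi>)
      have "\<bar>F \<phi> \<bullet> V \<phi>\<bar> \<le> norm (F \<phi>) * norm (V \<phi>)" by (rule Cauchy_Schwarz_ineq2)
      also have "\<dots> \<le> dom_bound * norm (V \<phi>)" using elim by (intro mult_right_mono) auto
      finally show ?case by simp
    qed
  qed (intro integrable_norm integrable_mult_right int V)+
  also have "\<dots> = dom_bound * H1_norm \<mu> V" by (simp add: H1_norm_def)
  finally show ?thesis .
qed

lemma dominated_zero: "dominated (\<lambda>_. 0)"
  unfolding dominated_def using S_form_nonneg by (auto intro!: AE_I2 add_nonneg_nonneg)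

lemma dual_norm_upper:
  assumes "dominated F" "V \<in> H1 \<mu>"
  shows "\<bar>LINT \<phi>|\<mu>. F \<phi> \<bullet> V \<phi>\<bar> \<le> dual_norm V"
  unfolding dual_norm_def
proof (rule cSUP_upper)
  show "bdd_above ((\<lambda>F. \<bar>LINT \<phi>|\<mu>. F \<phi> \<bullet> V \<phi>\<bar>) ` Collect dominated)"
    using pairing_le[OF _ assms(2)] by (intro bdd_aboveI2[where M = "dom_bound * H1_norm \<mu> V"]) simp
qed (use assms in simp)

lemma dual_norm_least:
  assumes "\<And>F. dominated F \<Longrightarrow> \<bar>LINT \<phi>|\<mu>. F \<phi> \<bullet> V \<phi>\<bar> \<le> b"
  shows "dual_norm V \<le> b"
  unfolding dual_norm_def by (rule cSUP_least) (use assms dominated_zero in auto)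

lemma dual_norm_le: "V \<in> H1 \<mu> \<Longrightarrow> dual_norm V \<le> dom_bound * H1_norm \<mu> V"
  by (intro dual_norm_least pairing_le)

text \<open>
  The field \<open>\<alpha> sgn V\<close> competes in the supremum, because
  \<open>2 \<alpha> |x| |y| \<le> \<alpha> |x|\<^sup>2 + \<alpha> |y|\<^sup>2\<close>.
\<close>

lemma dual_norm_ge:
  assumes "V \<in> H1 \<mu>"
  shows "\<alpha> * H1_norm \<mu> V \<le> dual_norm V"
proof -
  have V: "V \<in> borel_measurable \<mu>" using assms by (simp add: H1_def)
  define F where "F \<phi> = \<alpha> *\<^sub>R sgn (V \<phi>)" for \<phi>
  have "dominated F"
    unfolding dominated_def
  proof (intro conjI AE_I2 allI impI)
    have "sgn \<in> borel_measurable (borel :: (complex ^ 'n ^ 'n) measure)"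
    proof -
      have "(\<lambda>v :: complex ^ 'n ^ 'n. inverse (norm v) *\<^sub>R v) \<in> borel_measurable borel" by measurable
      then show ?thesis by (simp add: sgn_div_norm[abs_def])
    qed
    then have "(\<lambda>\<phi>. sgn (V \<phi>)) \<in> borel_measurable \<mu>" by (rule measurable_compose[OF V])
    then show "F \<in> borel_measurable \<mu>" unfolding F_def[abs_def] by measurable
    fix \<phi> u and x y :: "real ^ 'n"
    assume \<phi>: "\<phi> \<in> space \<mu>" and u: "cmod u = 1"
    have "sgn (V \<phi>) \<bullet> rank1 u x y \<le> norm (sgn (V \<phi>)) * norm (rank1 u x y)"
      by (rule norm_cauchy_schwarz)
    also have "\<dots> \<le> norm x * norm y"
      by (simp add: norm_rank1 u norm_sgn)
    finally have "2 * (F \<phi> \<bullet> rank1 u x y) \<le> \<alpha> * (2 * norm x * norm y)"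
      using \<alpha>_pos by (simp add: F_def)
    also have "\<dots> \<le> \<alpha> * ((norm x)\<^sup>2 + (norm y)\<^sup>2)"
      using \<alpha>_pos sum_squares_bound by (intro mult_left_mono) auto
    also have "\<dots> \<le> S_form \<phi> x + S_form \<phi> y"
      using S_lower[OF \<phi>] by (simp add: power2_norm_eq_inner distrib_left add_mono)
    finally show "2 * (F \<phi> \<bullet> rank1 u x y) \<le> S_form \<phi> x + S_form \<phi> y" .
  qed
  from dual_norm_upper[OF this assms] have "\<bar>LINT \<phi>|\<mu>. F \<phi> \<bullet> V \<phi>\<bar> \<le> dual_norm V" .
  moreover have "F \<phi> \<bullet> V \<phi> = \<alpha> * norm (V \<phi>)" for \<phi>
    by (cases "V \<phi> = 0") (simp_all add: F_def sgn_div_norm dot_square_norm power2_eq_square)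
  ultimately show ?thesis by (simp add: H1_norm_def)
qed

lemma AE_zero_if_dual_norm_le_0:
  assumes "V \<in> H1 \<mu>" "dual_norm V \<le> 0"
  shows "AE \<phi> in \<mu>. V \<phi> = 0"
proof -
  have V: "integrable \<mu> (\<lambda>\<phi>. norm (V \<phi>))" using assms(1) by (simp add: H1_def)
  have "\<alpha> * H1_norm \<mu> V \<le> 0" using dual_norm_ge[OF assms(1)] assms(2) by linarith
  then have "H1_norm \<mu> V \<le> 0" using \<alpha>_pos by (simp add: mult_le_0_iff)
  moreover have "0 \<le> H1_norm \<mu> V"
    unfolding H1_norm_def by (rule Bochner_Integration.integral_nonneg) simp
  ultimately have "(LINT \<phi>|\<mu>. norm (V \<phi>)) = 0" unfolding H1_norm_def by linarith
  then show ?thesis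
    using integral_nonneg_eq_0_iff_AE[OF V] by simp
qed

lemma kernel_S_form_integrable:
  assumes "l \<in> space \<mu>"
  shows "integrable \<mu> (\<lambda>\<phi>. g l \<phi> * S_form \<phi> x)"
proof -
  have S_form_meas: "(\<lambda>\<phi>. S_form \<phi> x) \<in> borel_measurable \<mu>"
    by (rule borel_measurable_continuous_on[OF _ S_meas])
      (unfold inner_vec_def matrix_vector_mult_def vec_lambda_beta, intro continuous_intros)
  have le: "AE \<phi> in \<mu>. norm (g l \<phi> * S_form \<phi> x) \<le> norm ((\<beta> * (x \<bullet> x)) * g l \<phi>)"
  proof (rule AE_I2)
    fix \<phi> assume \<phi>: "\<phi> \<in> space \<mu>"
    have "\<bar>S_form \<phi> x\<bar> \<le> \<bar>\<beta> * (x \<bullet> x)\<bar>" using S_form_nonneg[OF \<phi>, of x] S_upper[OF \<phi>, of x] by linarith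
    from mult_left_mono[OF this, of "\<bar>g l \<phi>\<bar>"]
    show "norm (g l \<phi> * S_form \<phi> x) \<le> norm ((\<beta> * (x \<bullet> x)) * g l \<phi>)"
      by (simp add: abs_mult mult.commute)
  qed
  show ?thesis
    by (rule Bochner_Integration.integrable_bound[OF _ _ le])
      (intro integrable_mult_right g_row(1) borel_measurable_times g_row_meas S_form_meas assms)+
qed

text \<open>
  The Lyapunov inequality enters here, and only here: domination of \<open>F\<close> is tested at \<open>A l x\<close> and
  \<open>A l y\<close> and averaged with \<open>g l\<close>, and the average of \<open>S\<close> is at most \<open>r\<close> times \<open>S l\<close>.
\<close>

lemma dominated_adjoint:
  assumes "dominated F"
  shows "dominated (\<lambda>l. (1 / r) *\<^sub>R adjoint F l)"
  unfolding dominated_def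
proof (intro conjI)
  have F [measurable]: "F \<in> borel_measurable \<mu>" using assms by (simp add: dominated_def)
  note bf = dominated_bounded_field[OF assms]
  have "(\<lambda>l. LINT \<phi>|\<mu>. g l \<phi> *\<^sub>R F \<phi>) \<in> borel_measurable \<mu>" by measurable
  moreover have "(\<lambda>l. transpose (A l)) \<in> borel_measurable \<mu>"
    by (rule borel_measurable_continuous_on[OF _ A_meas])
      (unfold transpose_def, intro continuous_intros)
  ultimately have "adjoint F \<in> borel_measurable \<mu>"
    unfolding adjoint_def[abs_def] by (rule borel_measurable_congruence[rotated])
  then show "(\<lambda>l. (1 / r) *\<^sub>R adjoint F l) \<in> borel_measurable \<mu>" by measurable
  show "AE l in \<mu>. \<forall>u x y. cmod u = 1 \<longrightarrow> 2 * (((1 / r) *\<^sub>R adjoint F l) \<bullet> rank1 u x y) \<le> S_form l x + S_form l y"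
    using decrease AE_space
  proof eventually_elim
    case (elim l)
    show ?case
    proof (intro allI impI)
      fix u x y assume u: "cmod u = 1"
      let ?x = "A l *v x" and ?y = "A l *v y"
      have AEF: "AE \<phi> in \<mu>. g l \<phi> * (2 * (F \<phi> \<bullet> rank1 u ?x ?y)) \<le> g l \<phi> * (S_form \<phi> ?x + S_form \<phi> ?y)"
        using assms[unfolded dominated_def, THEN conjunct2] AE_space
        by eventually_elim (simp add: g_nonneg elim(2) u mult_left_mono)
      have intF: "integrable \<mu> (\<lambda>\<phi>. 2 * ((g l \<phi> *\<^sub>R F \<phi>) \<bullet> rank1 u ?x ?y))"
        by (intro integrable_mult_right integrable_inner_left kernel_field_integrable[OF bf elim(2)])
      have "2 * (adjoint F l \<bullet> rank1 u x y) = 2 * ((LINT \<phi>|\<mu>. g l \<phi> *\<^sub>R F \<phi>) \<bullet> rank1 u ?x ?y)"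
        by (simp add: adjoint_def congruence_adjoint congruence_rank1)
      also have "\<dots> = (LINT \<phi>|\<mu>. 2 * ((g l \<phi> *\<^sub>R F \<phi>) \<bullet> rank1 u ?x ?y))"
        using integral_inner_left[OF kernel_field_integrable[OF bf elim(2)], of "rank1 u ?x ?y"]
        by (simp del: integral_inner_left)
      also have "\<dots> \<le> (LINT \<phi>|\<mu>. g l \<phi> * S_form \<phi> ?x + g l \<phi> * S_form \<phi> ?y)"
        using AEF intF
        by (intro integral_mono_AE Bochner_Integration.integrable_add kernel_S_form_integrable elim(2))
          (auto simp: algebra_simps)
      also have "\<dots> = (LINT \<phi>|\<mu>. g l \<phi> * S_form \<phi> ?x) + (LINT \<phi>|\<mu>. g l \<phi> * S_form \<phi> ?y)"
        by (intro Bochner_Integration.integral_add kernel_S_form_integrable elim(2))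
      also have "\<dots> \<le> r * S_form l x + r * S_form l y"
        using elim(1) by (intro add_mono) auto
      finally show "2 * (((1 / r) *\<^sub>R adjoint F l) \<bullet> rank1 u x y) \<le> S_form l x + S_form l y"
        using r_pos by (simp add: divide_le_eq algebra_simps)
    qed
  qed
qed

lemma dual_norm_T:
  assumes "V \<in> H1 \<mu>"
  shows "dual_norm (T V) \<le> r * dual_norm V"
proof (rule dual_norm_least)
  fix F assume F: "dominated F"
  have "(LINT \<phi>|\<mu>. F \<phi> \<bullet> T V \<phi>) = (LINT l|\<mu>. r * (((1 / r) *\<^sub>R adjoint F l) \<bullet> V l))"
    using adjoint_pairing[OF dominated_bounded_field[OF F] assms] r_pos by simp
  also have "\<dots> = r * (LINT l|\<mu>. ((1 / r) *\<^sub>R adjoint F l) \<bullet> V l)"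
    by (rule integral_mult_right_zero)
  finally show "\<bar>LINT \<phi>|\<mu>. F \<phi> \<bullet> T V \<phi>\<bar> \<le> r * dual_norm V"
    using dual_norm_upper[OF dominated_adjoint[OF F] assms] r_pos by (simp add: abs_mult divide_le_eq mult.commute)
qed

lemma cscale_pairing:
  "(LINT \<phi>|\<mu>. F \<phi> \<bullet> cscale z (V \<phi>)) = (LINT \<phi>|\<mu>. cscale (cnj z) (F \<phi>) \<bullet> V \<phi>)"
  by (simp add: inner_cscale_left)

lemma cscale_meas: "F \<in> borel_measurable \<mu> \<Longrightarrow> (\<lambda>\<phi>. cscale z (F \<phi>)) \<in> borel_measurable \<mu>"
  by (rule borel_measurable_continuous_on[OF linear_continuous_on[OF bounded_linear_cscale]])

lemma cscale_H1: "V \<in> H1 \<mu> \<Longrightarrow> (\<lambda>\<phi>. cscale z (V \<phi>)) \<in> H1 \<mu>"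
  unfolding H1_def by (simp add: integrable_bounded_linear[OF bounded_linear_cscale])

lemma dominated_cscale:
  assumes "dominated F" "cmod z = 1"
  shows "dominated (\<lambda>\<phi>. cscale z (F \<phi>))"
  unfolding dominated_def
proof (intro conjI)
  show "AE \<phi> in \<mu>. \<forall>u x y. cmod u = 1 \<longrightarrow> 2 * (cscale z (F \<phi>) \<bullet> rank1 u x y) \<le> S_form \<phi> x + S_form \<phi> y"
    using assms(1)[unfolded dominated_def, THEN conjunct2]
  proof eventually_elim
    case (elim \<phi>)
    have "2 * (cscale z (F \<phi>) \<bullet> rank1 u x y) \<le> S_form \<phi> x + S_form \<phi> y" if "cmod u = 1" for u x y
      using elim[rule_format, of "cnj z * u" x y] that assms(2)
      by (simp add: inner_cscale_left cscale_rank1 norm_mult)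
    then show ?case by blast
  qed
qed (use assms cscale_meas in \<open>auto simp: dominated_def\<close>)

lemma dual_norm_cscale_le:
  assumes "V \<in> H1 \<mu>"
  shows "dual_norm (\<lambda>\<phi>. cscale z (V \<phi>)) \<le> cmod z * dual_norm V"
proof (cases "z = 0")
  case True
  have "dual_norm (\<lambda>\<phi>. cscale z (V \<phi>)) \<le> 0"
    by (rule dual_norm_least) (simp add: True cscale_def inner_vec_def)
  then show ?thesis using True by simp
next
  case False
  show ?thesis
  proof (rule dual_norm_least)
    fix F assume F: "dominated F"
    \<comment> \<open>The phase of \<open>z\<close> is absorbed by \<open>F\<close>; domination does not see it.\<close>
    define u where "u = cnj (sgn z)"
    have u: "cmod u = 1" using False by (simp add: u_def norm_sgn)
    have cz: "cscale (cnj z) X = cmod z *\<^sub>R cscale u X" for X :: "complex ^ 'n ^ 'n"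
    proof -
      have "cnj z = complex_of_real (cmod z) * u"
        using False by (simp add: u_def sgn_eq)
      then show ?thesis by (simp add: cscale_cscale flip: cscale_of_real)
    qed
    have "(LINT \<phi>|\<mu>. F \<phi> \<bullet> cscale z (V \<phi>)) = cmod z * (LINT \<phi>|\<mu>. cscale u (F \<phi>) \<bullet> V \<phi>)"
      unfolding cscale_pairing cz by simp
    then show "\<bar>LINT \<phi>|\<mu>. F \<phi> \<bullet> cscale z (V \<phi>)\<bar> \<le> cmod z * dual_norm V"
      using dual_norm_upper[OF dominated_cscale[OF F u] assms] by (simp add: abs_mult mult_left_mono)
  qed
qed

lemma dual_norm_cscale_ge:
  assumes "V \<in> H1 \<mu>"
  shows "cmod z * dual_norm V \<le> dual_norm (\<lambda>\<phi>. cscale z (V \<phi>))"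
proof (cases "z = 0")
  case True
  then have "dominated (\<lambda>_. 0)" by (simp add: dominated_zero)
  from dual_norm_upper[OF this cscale_H1[OF assms, of z]] True show ?thesis by simp
next
  case False
  have "(\<lambda>\<phi>. cscale (1 / z) (cscale z (V \<phi>))) = V"
    using False by (simp add: cscale_cscale) (simp add: cscale_def)
  then have "dual_norm V \<le> cmod (1 / z) * dual_norm (\<lambda>\<phi>. cscale z (V \<phi>))"
    using dual_norm_cscale_le[OF cscale_H1[OF assms], of "1 / z" z] by simp
  with False show ?thesis by (simp add: norm_divide le_divide_eq mult.commute)
qed

text \<open>
  Injectivity of \<open>z - T\<close> and the bound for its inverse are both read off from this estimate.
\<close>

lemma a_priori:
  assumes V: "V \<in> H1 \<mu>" and W: "W \<in> H1 \<mu>"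
    and eq: "AE \<phi> in \<mu>. cscale z (V \<phi>) - T V \<phi> = W \<phi>"
  shows "(cmod z - r) * dual_norm V \<le> dual_norm W"
proof -
  have "dual_norm (\<lambda>\<phi>. cscale z (V \<phi>)) \<le> dual_norm (T V) + dual_norm W"
  proof (rule dual_norm_least)
    fix F assume F: "dominated F"
    note int = integrable_pairing[OF dominated_bounded_field[OF F]]
    have "(LINT \<phi>|\<mu>. F \<phi> \<bullet> cscale z (V \<phi>)) = (LINT \<phi>|\<mu>. F \<phi> \<bullet> T V \<phi> + F \<phi> \<bullet> W \<phi>)"
    proof (rule integral_cong_AE)
      show "AE \<phi> in \<mu>. F \<phi> \<bullet> cscale z (V \<phi>) = F \<phi> \<bullet> T V \<phi> + F \<phi> \<bullet> W \<phi>"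
        using eq
      proof eventually_elim
        case (elim \<phi>)
        show ?case unfolding elim[symmetric] by (simp add: inner_diff_right)
      qed
      show "(\<lambda>\<phi>. F \<phi> \<bullet> cscale z (V \<phi>)) \<in> borel_measurable \<mu>"
        by (rule borel_measurable_integrable[OF int[OF cscale_H1[OF V]]])
      show "(\<lambda>\<phi>. F \<phi> \<bullet> T V \<phi> + F \<phi> \<bullet> W \<phi>) \<in> borel_measurable \<mu>"
        by (intro borel_measurable_add borel_measurable_integrable int T_H1 V W)
    qed
    also have "\<dots> = (LINT \<phi>|\<mu>. F \<phi> \<bullet> T V \<phi>) + (LINT \<phi>|\<mu>. F \<phi> \<bullet> W \<phi>)"
      by (intro Bochner_Integration.integral_add int T_H1 V W)
    finally show "\<bar>LINT \<phi>|\<mu>. F \<phi> \<bullet> cscale z (V \<phi>)\<bar> \<le> dual_norm (T V) + dual_norm W"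
      using dual_norm_upper[OF F T_H1[OF V]] dual_norm_upper[OF F W] by linarith
  qed
  with dual_norm_cscale_ge[OF V, of z] dual_norm_T[OF V] show ?thesis by (simp add: left_diff_distrib)
qed

text \<open>
  Completeness of the space, in the form needed for Neumann series: an absolutely convergent series
  converges pointwise almost everywhere, and it may be paired term by term with bounded fields.
\<close>

lemma H1_series:
  fixes f :: "nat \<Rightarrow> 'a \<Rightarrow> complex ^ 'n ^ 'n"
  assumes f: "\<And>k. f k \<in> H1 \<mu>" and sum: "summable (\<lambda>k. H1_norm \<mu> (f k))"
  shows "(\<lambda>\<phi>. \<Sum>k. f k \<phi>) \<in> H1 \<mu>"
    and "bounded_field G \<Longrightarrow>
      (\<lambda>k. LINT \<phi>|\<mu>. G \<phi> \<bullet> f k \<phi>) sums (LINT \<phi>|\<mu>. G \<phi> \<bullet> (\<Sum>k. f k \<phi>))"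
proof -
  have int: "integrable \<mu> (f k)" for k using f by (simp add: H1_def)
  have [measurable]: "f k \<in> borel_measurable \<mu>" for k using int by simp
  have AEsum: "AE \<phi> in \<mu>. summable (\<lambda>k. norm (f k \<phi>))"
  proof -
    have "(\<integral>\<^sup>+\<phi>. (\<Sum>k. ennreal (norm (f k \<phi>))) \<partial>\<mu>) = (\<Sum>k. \<integral>\<^sup>+\<phi>. ennreal (norm (f k \<phi>)) \<partial>\<mu>)"
      by (rule nn_integral_suminf) measurable
    also have "\<dots> = (\<Sum>k. ennreal (H1_norm \<mu> (f k)))"
      unfolding H1_norm_def using int by (intro arg_cong[where f = suminf] ext nn_integral_eq_integral) auto
    also have "\<dots> \<noteq> \<infinity>"
      unfolding infinity_ennreal_def using sum
      by (intro ennreal_suminf_neq_top) (auto simp: H1_norm_def)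
    finally have "AE \<phi> in \<mu>. (\<Sum>k. ennreal (norm (f k \<phi>))) \<noteq> \<infinity>"
      by (intro nn_integral_noteq_infinite) auto
    then show ?thesis
      by eventually_elim (auto intro: summable_suminf_not_top)
  qed
  show "(\<lambda>\<phi>. \<Sum>k. f k \<phi>) \<in> H1 \<mu>"
    unfolding H1_def
    using integrable_suminf[OF int AEsum] sum by (simp add: H1_norm_def)
  assume G: "bounded_field G"
  then obtain c where Gm [measurable]: "G \<in> borel_measurable \<mu>"
    and c: "0 \<le> c" "AE \<phi> in \<mu>. norm (G \<phi>) \<le> c"
    by (auto simp: bounded_field_def)
  have intG: "integrable \<mu> (\<lambda>\<phi>. G \<phi> \<bullet> f k \<phi>)" for k by (rule integrable_pairing[OF G f])
  have le: "AE \<phi> in \<mu>. norm (G \<phi> \<bullet> f k \<phi>) \<le> c * norm (f k \<phi>)" for k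
    using c(2)
  proof eventually_elim
    case (elim \<phi>)
    have "\<bar>G \<phi> \<bullet> f k \<phi>\<bar> \<le> norm (G \<phi>) * norm (f k \<phi>)" by (rule Cauchy_Schwarz_ineq2)
    also have "\<dots> \<le> c * norm (f k \<phi>)" using elim by (intro mult_right_mono) auto
    finally show ?case by simp
  qed
  have sumG: "summable (\<lambda>k. LINT \<phi>|\<mu>. norm (G \<phi> \<bullet> f k \<phi>))"
  proof (rule summable_comparison_test')
    show "summable (\<lambda>k. c * H1_norm \<mu> (f k))" using sum by (rule summable_mult)
    fix k
    have "(LINT \<phi>|\<mu>. norm (G \<phi> \<bullet> f k \<phi>)) \<le> (LINT \<phi>|\<mu>. c * norm (f k \<phi>))"
      by (intro integral_mono_AE integrable_norm intG integrable_mult_right int le)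
    also have "\<dots> = c * H1_norm \<mu> (f k)" by (simp add: H1_norm_def)
    finally show "norm (LINT \<phi>|\<mu>. norm (G \<phi> \<bullet> f k \<phi>)) \<le> c * H1_norm \<mu> (f k)"
      by (simp add: Bochner_Integration.integral_nonneg)
  qed
  have AEsumG: "AE \<phi> in \<mu>. summable (\<lambda>k. norm (G \<phi> \<bullet> f k \<phi>))"
    using AEsum
  proof eventually_elim
    case (elim \<phi>)
    show ?case
    proof (rule summable_comparison_test')
      show "summable (\<lambda>k. norm (G \<phi>) * norm (f k \<phi>))" using elim by (rule summable_mult)
      show "norm (norm (G \<phi> \<bullet> f k \<phi>)) \<le> norm (G \<phi>) * norm (f k \<phi>)" for k
        by (simp add: Cauchy_Schwarz_ineq2)
    qed
  qed
  have "(\<lambda>k. LINT \<phi>|\<mu>. G \<phi> \<bullet> f k \<phi>) sums (LINT \<phi>|\<mu>. (\<Sum>k. G \<phi> \<bullet> f k \<phi>))"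
    by (rule sums_integral[OF intG AEsumG sumG])
  also have "(LINT \<phi>|\<mu>. (\<Sum>k. G \<phi> \<bullet> f k \<phi>)) = (LINT \<phi>|\<mu>. G \<phi> \<bullet> (\<Sum>k. f k \<phi>))"
  proof (rule integral_cong_AE)
    show "AE \<phi> in \<mu>. (\<Sum>k. G \<phi> \<bullet> f k \<phi>) = G \<phi> \<bullet> (\<Sum>k. f k \<phi>)"
      using AEsum
      by eventually_elim
        (rule bounded_linear.suminf[OF bounded_linear_inner_right summable_norm_cancel, symmetric])
  qed measurable
  finally show "(\<lambda>k. LINT \<phi>|\<mu>. G \<phi> \<bullet> f k \<phi>) sums (LINT \<phi>|\<mu>. G \<phi> \<bullet> (\<Sum>k. f k \<phi>))" .
qed

text \<open>
  The solution is the Neumann series \<open>V = \<Sum>\<^sub>k z\<^sup>-\<^sup>1 (z\<^sup>-\<^sup>1 T)\<^sup>k W\<close>, which converges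
  because \<open>z\<^sup>-\<^sup>1 T\<close> contracts the dual norm. That \<open>V\<close> solves the equation is checked weakly, against
  dominated fields: \<open>T\<close> is moved to its adjoint there, so that no interchange of \<open>T\<close> and the
  infinite sum is needed and the series telescopes.
\<close>

lemma resolvent_solution:
  fixes W :: "'a \<Rightarrow> complex ^ 'n ^ 'n"
  assumes z: "r < cmod z" and W: "W \<in> H1 \<mu>"
  obtains V where "V \<in> H1 \<mu>" "AE \<phi> in \<mu>. cscale z (V \<phi>) - T V \<phi> = W \<phi>"
proof -
  have z0: "z \<noteq> 0" using z r_pos by auto
  define f where
    "f k = ((\<lambda>U \<phi>. cscale (1 / z) (T U \<phi>)) ^^ k) (\<lambda>\<phi>. cscale (1 / z) (W \<phi>))" for k
  have f0: "f 0 = (\<lambda>\<phi>. cscale (1 / z) (W \<phi>))" and fS: "f (Suc k) = (\<lambda>\<phi>. cscale (1 / z) (T (f k) \<phi>))" for k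
    by (simp_all add: f_def)
  have cz: "cscale z (cscale (1 / z) X) = X" for X :: "complex ^ 'n ^ 'n"
    using z0 by (simp add: cscale_cscale) (simp add: cscale_def)
  have f_H1: "f k \<in> H1 \<mu>" for k
    by (induction k) (simp_all add: f0 fS cscale_H1 T_H1 W)
  have contr: "dual_norm (f k) \<le> (r / cmod z) ^ k * dual_norm (f 0)" for k
  proof (induction k)
    case (Suc k)
    have "dual_norm (f (Suc k)) \<le> cmod (1 / z) * dual_norm (T (f k))"
      unfolding fS by (rule dual_norm_cscale_le[OF T_H1[OF f_H1]])
    also have "\<dots> \<le> cmod (1 / z) * (r * dual_norm (f k))"
      by (intro mult_left_mono dual_norm_T f_H1) simp
    also have "\<dots> = (r / cmod z) * dual_norm (f k)" by (simp add: norm_divide)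
    also have "\<dots> \<le> (r / cmod z) * ((r / cmod z) ^ k * dual_norm (f 0))"
      using Suc r_pos by (intro mult_left_mono) auto
    finally show ?case by simp
  qed simp
  have "summable (\<lambda>k. H1_norm \<mu> (f k))"
  proof (rule summable_comparison_test')
    show "summable (\<lambda>k. (r / cmod z) ^ k * (dual_norm (f 0) / \<alpha>))"
      using z r_pos by (intro summable_mult2 summable_geometric) (auto simp: divide_less_eq)
    fix k
    have "\<alpha> * H1_norm \<mu> (f k) \<le> (r / cmod z) ^ k * dual_norm (f 0)"
      using dual_norm_ge[OF f_H1] contr by (rule order_trans)
    then show "norm (H1_norm \<mu> (f k)) \<le> (r / cmod z) ^ k * (dual_norm (f 0) / \<alpha>)"
      using \<alpha>_pos by (simp add: H1_norm_def Bochner_Integration.integral_nonneg le_divide_eq mult.commute)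
  qed
  note series = H1_series[OF f_H1 this]
  define V where "V \<phi> = (\<Sum>k. f k \<phi>)" for \<phi>
  have V: "V \<in> H1 \<mu>" unfolding V_def[abs_def] by (rule series(1))
  define D where "D \<phi> = cscale z (V \<phi>) - T V \<phi> - W \<phi>" for \<phi>
  have D: "D \<in> H1 \<mu>"
    using cscale_H1[OF V] T_H1[OF V] W unfolding H1_def D_def[abs_def] by simp
  have "dual_norm D \<le> 0"
  proof (rule dual_norm_least)
    fix F assume F: "dominated F"
    note bF = dominated_bounded_field[OF F]
    note int = integrable_pairing[OF bF]
    have bz: "bounded_field (\<lambda>\<phi>. cscale (cnj z) (F \<phi>))"
      using bF cscale_meas unfolding bounded_field_def norm_cscale
      by (auto intro!: exI[of _ "cmod z * _"] mult_left_mono elim!: eventually_mono)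
    have ba: "bounded_field (adjoint F)"
    proof -
      obtain c where c: "0 \<le> c" "AE l in \<mu>. norm ((1 / r) *\<^sub>R adjoint F l) \<le> c"
        and m: "(\<lambda>l. (1 / r) *\<^sub>R adjoint F l) \<in> borel_measurable \<mu>"
        using dominated_bounded_field[OF dominated_adjoint[OF F]] by (auto simp: bounded_field_def)
      have "(\<lambda>l. r *\<^sub>R ((1 / r) *\<^sub>R adjoint F l)) \<in> borel_measurable \<mu>"
        by (rule borel_measurable_scaleR[OF borel_measurable_const m])
      moreover have "(\<lambda>l. r *\<^sub>R ((1 / r) *\<^sub>R adjoint F l)) = adjoint F" using r_pos by simp
      ultimately have "adjoint F \<in> borel_measurable \<mu>" by (simp only:)
      moreover have "AE l in \<mu>. norm (adjoint F l) \<le> r * c"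
        using c(2) by eventually_elim (use r_pos in \<open>simp add: divide_le_eq mult.commute\<close>)
      ultimately show ?thesis using c(1) r_pos unfolding bounded_field_def
        by (intro conjI exI[of _ "r * c"]) auto
    qed
    \<comment> \<open>Both pairings are sums of the same sequence, which for \<open>T V\<close> lacks its first term, the
        pairing with \<open>W\<close>.\<close>
    define a where "a k = (LINT \<phi>|\<mu>. F \<phi> \<bullet> cscale z (f k \<phi>))" for k
    have a0: "a 0 = (LINT \<phi>|\<mu>. F \<phi> \<bullet> W \<phi>)"
      unfolding a_def f0 cz ..
    have aS: "a (Suc k) = (LINT l|\<mu>. adjoint F l \<bullet> f k l)" for k
      unfolding a_def fS cz by (rule adjoint_pairing[OF bF f_H1])
    have "a sums (LINT \<phi>|\<mu>. F \<phi> \<bullet> cscale z (V \<phi>))"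
      using series(2)[OF bz] unfolding a_def cscale_pairing V_def .
    moreover have "(\<lambda>k. a (Suc k)) sums (LINT \<phi>|\<mu>. F \<phi> \<bullet> T V \<phi>)"
      using series(2)[OF ba] unfolding aS adjoint_pairing[OF bF V] V_def .
    then have "a sums ((LINT \<phi>|\<mu>. F \<phi> \<bullet> T V \<phi>) + a 0)"
      by (simp add: sums_Suc_iff)
    ultimately have "(LINT \<phi>|\<mu>. F \<phi> \<bullet> cscale z (V \<phi>))
        = (LINT \<phi>|\<mu>. F \<phi> \<bullet> T V \<phi>) + (LINT \<phi>|\<mu>. F \<phi> \<bullet> W \<phi>)"
      unfolding a0[symmetric] by (rule sums_unique2)
    moreover have "(LINT \<phi>|\<mu>. F \<phi> \<bullet> D \<phi>) = (LINT \<phi>|\<mu>. F \<phi> \<bullet> cscale z (V \<phi>))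
        - (LINT \<phi>|\<mu>. F \<phi> \<bullet> T V \<phi>) - (LINT \<phi>|\<mu>. F \<phi> \<bullet> W \<phi>)"
      unfolding D_def inner_diff_right
      using int[OF cscale_H1[OF V]] int[OF T_H1[OF V]] int[OF W] by simp
    ultimately show "\<bar>LINT \<phi>|\<mu>. F \<phi> \<bullet> D \<phi>\<bar> \<le> 0" by simp
  qed
  from AE_zero_if_dual_norm_le_0[OF D this] have "AE \<phi> in \<mu>. cscale z (V \<phi>) - T V \<phi> = W \<phi>"
    by (simp add: D_def)
  with V show ?thesis by (rule that)
qed

lemma in_resolvent_set:
  assumes z: "r < cmod z"
  shows "z \<in> resolvent_set \<mu> T"
  unfolding resolvent_set_def mem_Collect_eq
proof (intro conjI ballI impI exI)
  fix V :: "'a \<Rightarrow> complex ^ 'n ^ 'n" assume V: "V \<in> H1 \<mu>" "AE \<phi> in \<mu>. cscale z (V \<phi>) - T V \<phi> = 0"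
  have 0: "(\<lambda>_. 0) \<in> H1 \<mu>" by (simp add: H1_def)
  have "dual_norm (\<lambda>_. 0) \<le> 0" by (rule dual_norm_least) simp
  with a_priori[OF V(1) 0 V(2)] have "(cmod z - r) * dual_norm V \<le> 0" by linarith
  then have "dual_norm V \<le> 0" using z by (simp add: mult_le_0_iff)
  then show "AE \<phi> in \<mu>. V \<phi> = 0" by (rule AE_zero_if_dual_norm_le_0[OF V(1)])
next
  fix W :: "'a \<Rightarrow> complex ^ 'n ^ 'n" assume W: "W \<in> H1 \<mu>"
  obtain V where V: "V \<in> H1 \<mu>" "AE \<phi> in \<mu>. cscale z (V \<phi>) - T V \<phi> = W \<phi>"
    using resolvent_solution[OF z W] .
  have "(cmod z - r) * (\<alpha> * H1_norm \<mu> V) \<le> (cmod z - r) * dual_norm V"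
    using z by (intro mult_left_mono dual_norm_ge V) simp
  also have "\<dots> \<le> dual_norm W" by (rule a_priori[OF V(1) W V(2)])
  also have "\<dots> \<le> dom_bound * H1_norm \<mu> W" by (rule dual_norm_le[OF W])
  finally have "H1_norm \<mu> V \<le> (dom_bound / ((cmod z - r) * \<alpha>)) * H1_norm \<mu> W"
    using z \<alpha>_pos by (simp add: le_divide_eq ac_simps)
  with V show "\<exists>V\<in>H1 \<mu>. (AE \<phi> in \<mu>. cscale z (V \<phi>) - T V \<phi> = W \<phi>)
      \<and> H1_norm \<mu> V \<le> (dom_bound / ((cmod z - r) * \<alpha>)) * H1_norm \<mu> W"
    by blast
qed

theorem spec_radius_le: "spec_radius \<mu> T \<le> ennreal r"
  by (rule spec_radius_leI) (rule in_resolvent_set)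

end

section \<open>Piecewise constant Lyapunov functions\<close>

text \<open>
  Real intervals are Borel sets, and a box is a finite intersection of their preimages.
\<close>

lemma is_box_borel:
  fixes B :: "(real ^ 'p) set"
  assumes "is_box B"
  shows "B \<in> sets borel"
proof -
  from assms obtain J :: "'p \<Rightarrow> real set" where J: "\<And>k. is_interval (J k)"
    and B: "B = {x. \<forall>k. x $ k \<in> J k}" by (auto simp: is_box_def)
  have "J k \<in> sets borel" for k
    using J[of k] by (rule real_interval_borel_measurable)
  then have "(\<lambda>x :: real ^ 'p. x $ k) -` J k \<inter> space borel \<in> sets borel" for k
    by (intro measurable_sets[OF borel_measurable_continuous_onI]) (auto intro!: continuous_intros)
  then have "(\<Inter>k. (\<lambda>x :: real ^ 'p. x $ k) -` J k) \<in> sets borel"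
    by (intro sets.countable_INT'') auto
  moreover have "B = (\<Inter>k. (\<lambda>x :: real ^ 'p. x $ k) -` J k)" by (auto simp: B)
  ultimately show ?thesis by simp
qed

locale finite_partition =
  fixes \<mu> :: "'a measure" and B :: "'k::finite \<Rightarrow> 'a set"
  assumes B_sets: "\<And>i. B i \<in> sets \<mu>"
    and B_disjoint: "disjoint_family B"
    and B_cover: "(\<Union>i. B i) = space \<mu>"
begin

definition step_function :: "('k \<Rightarrow> 'b::euclidean_space) \<Rightarrow> 'a \<Rightarrow> 'b" where
  "step_function X \<phi> = (\<Sum>i\<in>UNIV. indicator (B i) \<phi> *\<^sub>R X i)"

lemma step_function_eq:
  assumes "\<phi> \<in> B i"
  shows "step_function X \<phi> = X i"
proof -
  have "indicator (B j) \<phi> *\<^sub>R X j = (if j = i then X i else 0)" for j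
    using assms B_disjoint by (auto simp: disjoint_family_on_def indicator_def)
  then show ?thesis by (simp add: step_function_def)
qed

lemma step_function_meas: "step_function X \<in> borel_measurable \<mu>"
  unfolding step_function_def[abs_def]
  by (intro borel_measurable_sum borel_measurable_scaleR borel_measurable_indicator B_sets) auto

end

text \<open>
  The Lyapunov function is piecewise constant in the mode, equal to \<open>S i\<close> on \<open>B i\<close>. Its average under
  the law \<open>g l\<close> of the next mode is the sum of the \<open>S j\<close> with the box weights, so that the
  hypothesis is the Lyapunov inequality with a fixed loss \<open>e |x|\<^sup>2\<close>. Finitely many matrices are
  uniformly comparable with \<open>|x|\<^sup>2\<close>, and therefore the fixed loss is a contraction factor.
\<close>

theorem piecewise_spec_radius_less_1:
  fixes \<mu> :: "'a measure" and B :: "'k::finite \<Rightarrow> 'a set" and A :: "'a \<Rightarrow> real ^ 'n ^ 'n"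
  assumes "sigma_finite_measure \<mu>" and g: "transition_density \<mu> g" and A: "A \<in> H_sup \<mu>"
    and "finite_partition \<mu> B"
    and S: "\<And>i. pos_def (S i)" and e: "0 < e"
    and decrease: "\<And>i. AE l in \<mu>. l \<in> B i \<longrightarrow> (\<forall>x.
       (\<Sum>j\<in>UNIV. box_weight \<mu> g B l j * ((A l *v x) \<bullet> (S j *v (A l *v x))))
         \<le> x \<bullet> (S i *v x) - e * (x \<bullet> x))"
  shows "spec_radius \<mu> (L_op \<mu> g A) < 1"
proof -
  interpret sigma_finite_measure \<mu> by fact
  interpret P: finite_partition \<mu> B by fact
  have "\<exists>a>0. \<forall>x. a * (x \<bullet> x) \<le> x \<bullet> (S i *v x)" for i
    by (rule pos_def_uniform[OF S])
  then obtain a where a: "\<And>i. 0 < a i" "\<And>i x. a i * (x \<bullet> x) \<le> x \<bullet> (S i *v x)" by metis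
  have "\<exists>b. \<forall>x. x \<bullet> (S i *v x) \<le> b * (x \<bullet> x)" for i
  proof -
    have "x \<bullet> (S i *v x) \<le> onorm ((*v) (S i)) * (x \<bullet> x)" for x
    proof -
      have "x \<bullet> (S i *v x) \<le> norm x * norm (S i *v x)" by (rule norm_cauchy_schwarz)
      also have "\<dots> \<le> norm x * (onorm ((*v) (S i)) * norm x)"
        by (intro mult_left_mono onorm matrix_vector_mul_bounded_linear) simp
      finally show ?thesis by (simp add: dot_square_norm power2_eq_square ac_simps)
    qed
    then show ?thesis by blast
  qed
  then obtain b where b: "\<And>i x. x \<bullet> (S i *v x) \<le> b i * (x \<bullet> x)" by metis
  define \<alpha> where "\<alpha> = Min (range a)"
  define \<beta> where "\<beta> = max 1 (Max (range b))"
  \<comment> \<open>Since \<open>x \<bullet> S i x \<le> \<beta> |x|\<^sup>2\<close>, the loss \<open>e |x|\<^sup>2\<close> is at least the fraction \<open>e / \<beta>\<close>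
      of the present value. The maximum with \<open>1 / 2\<close> keeps the factor positive.\<close>
  define r where "r = max (1 / 2) (1 - e / \<beta>)"
  have \<alpha>: "0 < \<alpha>" "\<alpha> * (x \<bullet> x) \<le> x \<bullet> (S i *v x)" for i x
  proof -
    show "0 < \<alpha>" using a(1) by (simp add: \<alpha>_def)
    have "\<alpha> \<le> a i" by (simp add: \<alpha>_def)
    then have "\<alpha> * (x \<bullet> x) \<le> a i * (x \<bullet> x)" by (intro mult_right_mono) auto
    with a(2)[of i x] show "\<alpha> * (x \<bullet> x) \<le> x \<bullet> (S i *v x)" by linarith
  qed
  have \<beta>: "0 < \<beta>" "x \<bullet> (S i *v x) \<le> \<beta> * (x \<bullet> x)" for i x
  proof -
    show "0 < \<beta>" by (simp add: \<beta>_def)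
    have "b i \<le> \<beta>" by (simp add: \<beta>_def le_max_iff_disj)
    then have "b i * (x \<bullet> x) \<le> \<beta> * (x \<bullet> x)" by (intro mult_right_mono) auto
    with b[of x i] show "x \<bullet> (S i *v x) \<le> \<beta> * (x \<bullet> x)" by linarith
  qed
  have r: "0 < r" "r < 1" using e \<beta>(1) by (auto simp: r_def)
  have contract: "x \<bullet> (S i *v x) - e * (x \<bullet> x) \<le> r * (x \<bullet> (S i *v x))" for i x
  proof -
    have "(e / \<beta>) * (x \<bullet> (S i *v x)) \<le> (e / \<beta>) * (\<beta> * (x \<bullet> x))"
      using e \<beta> by (intro mult_left_mono) auto
    also have "\<dots> = e * (x \<bullet> x)" using \<beta>(1) by simp
    finally have "x \<bullet> (S i *v x) - e * (x \<bullet> x) \<le> (1 - e / \<beta>) * (x \<bullet> (S i *v x))"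
      by (simp add: left_diff_distrib)
    also have "0 \<le> x \<bullet> (S i *v x)"
      using \<alpha>(2)[of x i] \<alpha>(1) by (meson inner_ge_zero less_imp_le mult_nonneg_nonneg order_trans)
    then have "(1 - e / \<beta>) * (x \<bullet> (S i *v x)) \<le> r * (x \<bullet> (S i *v x))"
      by (intro mult_right_mono) (simp add: r_def)
    finally show ?thesis .
  qed
  have cover: "\<exists>i. \<phi> \<in> B i" if "\<phi> \<in> space \<mu>" for \<phi> using that P.B_cover by blast
  interpret lyapunov_function \<mu> g A "P.step_function S" \<alpha> \<beta> r
  proof
    show "transition_density \<mu> g" "A \<in> H_sup \<mu>" "P.step_function S \<in> borel_measurable \<mu>" "0 < \<alpha>" "0 < r"
      by (fact g A P.step_function_meas \<alpha>(1) r(1))+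
    show "\<alpha> * (x \<bullet> x) \<le> x \<bullet> (P.step_function S \<phi> *v x)" if "\<phi> \<in> space \<mu>" for \<phi> x
      using cover[OF that] \<alpha>(2) by (auto simp: P.step_function_eq)
    show "x \<bullet> (P.step_function S \<phi> *v x) \<le> \<beta> * (x \<bullet> x)" if "\<phi> \<in> space \<mu>" for \<phi> x
      using cover[OF that] \<beta>(2) by (auto simp: P.step_function_eq)
    have avg: "(LINT \<phi>|\<mu>. g l \<phi> * (y \<bullet> (P.step_function S \<phi> *v y)))
        = (\<Sum>j\<in>UNIV. box_weight \<mu> g B l j * (y \<bullet> (S j *v y)))" if l: "l \<in> space \<mu>" for l y
    proof -
      note gl = transition_density_row(2)[OF g l]
      have int: "integrable \<mu> (\<lambda>\<phi>. indicator (B j) \<phi> *\<^sub>R g l \<phi>)" for j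
        by (rule integrable_mult_indicator[OF P.B_sets gl])
      have "(LINT \<phi>|\<mu>. g l \<phi> * (y \<bullet> (P.step_function S \<phi> *v y)))
          = (LINT \<phi>|\<mu>. (\<Sum>j\<in>UNIV. (indicator (B j) \<phi> *\<^sub>R g l \<phi>) * (y \<bullet> (S j *v y))))"
      proof (rule Bochner_Integration.integral_cong[OF refl])
        fix \<phi> assume "\<phi> \<in> space \<mu>"
        then obtain i where i: "\<phi> \<in> B i" using cover by blast
        have "(\<Sum>j\<in>UNIV. (indicator (B j) \<phi> *\<^sub>R g l \<phi>) * (y \<bullet> (S j *v y)))
            = P.step_function (\<lambda>j. g l \<phi> * (y \<bullet> (S j *v y))) \<phi>"
          by (simp add: P.step_function_def mult.assoc)
        then show "g l \<phi> * (y \<bullet> (P.step_function S \<phi> *v y))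
            = (\<Sum>j\<in>UNIV. (indicator (B j) \<phi> *\<^sub>R g l \<phi>) * (y \<bullet> (S j *v y)))"
          by (simp add: P.step_function_eq[OF i])
      qed
      also have "\<dots> = (\<Sum>j\<in>UNIV. LINT \<phi>|\<mu>. (indicator (B j) \<phi> *\<^sub>R g l \<phi>) * (y \<bullet> (S j *v y)))"
        by (intro Bochner_Integration.integral_sum integrable_mult_left int)
      also have "\<dots> = (\<Sum>j\<in>UNIV. box_weight \<mu> g B l j * (y \<bullet> (S j *v y)))"
        unfolding box_weight_def set_lebesgue_integral_def
        by (intro sum.cong refl integral_mult_left_zero)
      finally show ?thesis .
    qed
    have "AE l in \<mu>. \<forall>i. l \<in> B i \<longrightarrow> (\<forall>x.
       (\<Sum>j\<in>UNIV. box_weight \<mu> g B l j * ((A l *v x) \<bullet> (S j *v (A l *v x))))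
         \<le> x \<bullet> (S i *v x) - e * (x \<bullet> x))"
      using decrease by (simp add: AE_all_countable)
    then show "AE l in \<mu>. \<forall>x. (LINT \<phi>|\<mu>. g l \<phi> * ((A l *v x) \<bullet> (P.step_function S \<phi> *v (A l *v x))))
        \<le> r * (x \<bullet> (P.step_function S l *v x))"
      using AE_space
    proof eventually_elim
      case (elim l)
      then obtain i where i: "l \<in> B i" using cover by blast
      show ?case
        unfolding avg[OF elim(2)] P.step_function_eq[OF i]
        using elim(1) i by (blast intro: order_trans[OF _ contract])
    qed
  qed
  have "spec_radius \<mu> (L_op \<mu> g A) \<le> ennreal r" by (rule spec_radius_le)
  also have "\<dots> < 1" using r by (simp add: ennreal_less_one_iff)
  finally show ?thesis .
qed

section \<open>Detectability by piecewise constant gains\<close>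

lemma mat_norm_add_mult_le: "mat_norm (X + Y ** Z) \<le> mat_norm X + mat_norm Y * mat_norm Z"
proof -
  have bl: "bounded_linear ((*v) M)" for M :: "real ^ 'c ^ 'd"
    by (rule matrix_vector_mul_bounded_linear)
  have "mat_norm (X + Y ** Z) = onorm (\<lambda>x. X *v x + ((*v) Y \<circ> (*v) Z) x)"
    by (simp add: mat_norm_def matrix_vector_mult_add_rdistrib matrix_vector_mul_assoc)
  also have "\<dots> \<le> onorm ((*v) X) + onorm ((*v) Y \<circ> (*v) Z)"
    by (intro onorm_triangle) (simp_all add: comp_def bounded_linear_compose)
  also have "onorm ((*v) Y \<circ> (*v) Z) \<le> onorm ((*v) Y) * onorm ((*v) Z)"
    by (intro onorm_compose) simp_all
  finally show ?thesis by (simp add: mat_norm_def)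
qed

lemma mat_norm_nonneg: "0 \<le> mat_norm X"
  by (simp add: mat_norm_def onorm_pos_le)

lemma H_sup_add_mult:
  assumes X: "X \<in> H_sup \<mu>" and Y: "Y \<in> H_sup \<mu>" and Z: "Z \<in> H_sup \<mu>"
  shows "(\<lambda>\<phi>. X \<phi> + Y \<phi> ** Z \<phi>) \<in> H_sup \<mu>"
proof -
  have m: "X \<in> borel_measurable \<mu>" "Y \<in> borel_measurable \<mu>" "Z \<in> borel_measurable \<mu>"
    using assms by (auto simp: H_sup_def)
  have "(\<lambda>\<phi>. Y \<phi> ** Z \<phi>) \<in> borel_measurable \<mu>"
    by (rule borel_measurable_continuous_Pair[OF m(2,3)])
      (unfold matrix_matrix_mult_def, intro continuous_intros)
  then have "(\<lambda>\<phi>. X \<phi> + Y \<phi> ** Z \<phi>) \<in> borel_measurable \<mu>"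
    using m(1) by (intro borel_measurable_add)
  moreover obtain a b c where
    "AE \<phi> in \<mu>. mat_norm (X \<phi>) \<le> a" "AE \<phi> in \<mu>. mat_norm (Y \<phi>) \<le> b" "AE \<phi> in \<mu>. mat_norm (Z \<phi>) \<le> c"
    using assms by (auto simp: H_sup_def)
  then have "AE \<phi> in \<mu>. mat_norm (X \<phi> + Y \<phi> ** Z \<phi>) \<le> a + b * c"
  proof eventually_elim
    case (elim \<phi>)
    have "mat_norm (Y \<phi>) * mat_norm (Z \<phi>) \<le> b * c"
      using elim mat_norm_nonneg[of "Y \<phi>"] mat_norm_nonneg[of "Z \<phi>"]
      by (intro mult_mono) auto
    with elim(1) mat_norm_add_mult_le[of "X \<phi>" "Y \<phi>" "Z \<phi>"] show ?case by linarith
  qed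
  ultimately show ?thesis by (auto simp: H_sup_def)
qed

lemma (in finite_partition) H_sup_piecewise_constant:
  assumes "\<And>i \<phi>. \<phi> \<in> B i \<Longrightarrow> L \<phi> = X i"
  shows "L \<in> H_sup \<mu>"
proof -
  have B: "\<exists>i. \<phi> \<in> B i" if "\<phi> \<in> space \<mu>" for \<phi> using that B_cover by blast
  have eq: "L \<phi> = step_function X \<phi>" if "\<phi> \<in> space \<mu>" for \<phi>
    using B[OF that] assms by (auto simp: step_function_eq)
  have "L \<in> borel_measurable \<mu>"
    by (rule measurable_cong[THEN iffD2, OF eq step_function_meas])
  moreover have "AE \<phi> in \<mu>. mat_norm (L \<phi>) \<le> Max (range (\<lambda>i. mat_norm (X i)))"
  proof (rule AE_I2)
    fix \<phi> assume "\<phi> \<in> space \<mu>"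
    then obtain i where "\<phi> \<in> B i" using B by blast
    then show "mat_norm (L \<phi>) \<le> Max (range (\<lambda>i. mat_norm (X i)))"
      using assms by (auto intro!: Max_ge)
  qed
  ultimately show ?thesis by (auto simp: H_sup_def)
qed

lemma box_weight_nonneg:
  assumes "transition_density \<mu> g" "\<phi> \<in> space \<mu>"
  shows "0 \<le> box_weight \<mu> g B \<phi> j"
  unfolding box_weight_def set_lebesgue_integral_def
  using assms by (intro Bochner_Integration.integral_nonneg) (auto simp: transition_density_def)

theorem theorem5p8:
  fixes \<tau>min \<tau>max :: real
    and \<mu> :: "(real ^ 'p) measure"
    and g :: "real ^ 'p \<Rightarrow> real ^ 'p \<Rightarrow> real"
    and A :: "real ^ 'p \<Rightarrow> real ^ 'n ^ 'n"
    and C :: "real ^ 'p \<Rightarrow> real ^ 'n ^ 'r"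
    and B :: "'k::finite \<Rightarrow> (real ^ 'p) set"
    and c :: "'k \<Rightarrow> real ^ 'p"
    and w :: "real ^ 'p \<Rightarrow> 'k \<Rightarrow> real"
    and \<Upsilon>A :: "'k \<Rightarrow> real ^ 'n ^ 'n"
    and \<Upsilon>C :: "'k \<Rightarrow> real ^ 'n ^ 'r"
    and \<Upsilon>w :: "'k \<Rightarrow> real ^ ('k \<times> 'n) ^ 'n"
    and \<kappa>A \<kappa>w :: "'k \<Rightarrow> real"
    and S U :: "'k \<Rightarrow> real ^ 'n ^ 'n"
    and Lbar :: "'k \<Rightarrow> real ^ 'r ^ 'n"
    and lam \<rho> :: "'k \<Rightarrow> real"
    and L :: "real ^ 'p \<Rightarrow> real ^ 'r ^ 'n"
  assumes sets_\<mu>: "sets \<mu> = sets (restrict_space borel (tau_cube \<tau>min \<tau>max))"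
    and sigma_finite: "sigma_finite_measure \<mu>"
    and density_g: "transition_density \<mu> g"
    and A_sup: "A \<in> H_sup \<mu>"
    and C_sup: "C \<in> H_sup \<mu>"
    and boxes: "\<And>i. is_box (B i)"
    and boxes_disjoint: "disjoint_family B"
    and boxes_cover: "(\<Union>i. B i) = tau_cube \<tau>min \<tau>max"
    and centres: "\<And>i. c i \<in> B i"
    and w_def: "w = box_weight \<mu> g B"
    and \<Upsilon>A_def: "\<Upsilon>A = (\<lambda>i. A (c i))"
    and \<Upsilon>C_def: "\<Upsilon>C = (\<lambda>i. C (c i))"
    and \<Upsilon>w_def: "\<Upsilon>w = (\<lambda>i. sqrt_row (w (c i)))"
    and \<kappa>_pos: "\<And>i. 0 < \<kappa>A i" "\<And>i. 0 < \<kappa>w i"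
    and \<kappa>A_bound: "\<And>i. AE \<phi> in \<mu>. \<phi> \<in> B i \<longrightarrow>
           mat_norm (vstack (A \<phi>) (C \<phi>) - vstack (\<Upsilon>A i) (\<Upsilon>C i)) \<le> \<kappa>A i"
    and \<kappa>w_bound: "\<And>i. AE \<phi> in \<mu>. \<phi> \<in> B i \<longrightarrow>
           mat_norm (sqrt_row (w \<phi>) - \<Upsilon>w i) \<le> \<kappa>w i"
    and S_pos: "\<And>i. pos_def (S i)"
    and lam_\<rho>_pos: "\<And>i. 0 < lam i" "\<And>i. 0 < \<rho> i"
    and lmi: "\<And>i. pos_def (lmi_matrix (\<Upsilon>A i) (\<Upsilon>C i) (\<Upsilon>w i) (\<kappa>A i) (\<kappa>w i)
                              S (S i) (U i) (Lbar i) (lam i) (\<rho> i))"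
    and L_def: "\<And>i \<phi>. \<phi> \<in> B i \<Longrightarrow> L \<phi> = matrix_inv (U i) ** Lbar i"
  shows "(\<forall>i. invertible (U i)) \<and> stoch_detectable_by \<mu> g C A L"
proof
  show U: "\<forall>i. invertible (U i)" using lmi lmi_U_invertible by blast
  have sp: "space \<mu> = tau_cube \<tau>min \<tau>max"
    using sets_eq_imp_space_eq[OF sets_\<mu>] by (simp add: space_restrict_space)
  interpret P: finite_partition \<mu> B
  proof
    show "disjoint_family B" by (fact boxes_disjoint)
    show "(\<Union>i. B i) = space \<mu>" by (simp add: boxes_cover sp)
    fix i
    have "tau_cube \<tau>min \<tau>max \<inter> B i = B i" using boxes_cover by blast
    then show "B i \<in> sets \<mu>"
      unfolding sets_\<mu> sets_restrict_space using is_box_borel[OF boxes, of i] by (metis image_eqI)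
  qed
  have L_sup: "L \<in> H_sup \<mu>" using L_def by (rule P.H_sup_piecewise_constant)
  have "\<exists>e>0. \<forall>x. e * (x \<bullet> x) \<le> x \<bullet> (lmi_matrix (\<Upsilon>A i) (\<Upsilon>C i) (\<Upsilon>w i) (\<kappa>A i) (\<kappa>w i)
                              S (S i) (U i) (Lbar i) (lam i) (\<rho> i) *v x)" for i
    by (rule pos_def_uniform[OF lmi])
  then obtain e where e: "\<And>i. 0 < e i"
    "\<And>i x. e i * (x \<bullet> x) \<le> x \<bullet> (lmi_matrix (\<Upsilon>A i) (\<Upsilon>C i) (\<Upsilon>w i) (\<kappa>A i) (\<kappa>w i)
                              S (S i) (U i) (Lbar i) (lam i) (\<rho> i) *v x)"
    by metis
  \<comment> \<open>There are finitely many boxes, so one margin serves them all.\<close>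
  define e0 where "e0 = Min (range e)"
  have e0: "0 < e0" "e0 \<le> e i" for i using e(1) by (auto simp: e0_def)
  have "spec_radius \<mu> (L_op \<mu> g (\<lambda>\<phi>. A \<phi> + L \<phi> ** C \<phi>)) < 1"
  proof (rule piecewise_spec_radius_less_1[where S = S])
    show "(\<lambda>\<phi>. A \<phi> + L \<phi> ** C \<phi>) \<in> H_sup \<mu>" by (intro H_sup_add_mult A_sup L_sup C_sup)
    fix i
    show "AE l in \<mu>. l \<in> B i \<longrightarrow> (\<forall>x.
       (\<Sum>j\<in>UNIV. box_weight \<mu> g B l j *
          (((A l + L l ** C l) *v x) \<bullet> (S j *v ((A l + L l ** C l) *v x))))
         \<le> x \<bullet> (S i *v x) - e0 * (x \<bullet> x))"
      using \<kappa>A_bound[of i] \<kappa>w_bound[of i] AE_space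
    proof eventually_elim
      case (elim l)
      show ?case
      proof (intro impI allI)
        fix x assume l: "l \<in> B i"
        have "(\<Sum>j\<in>UNIV. w l j *
            (((A l + L l ** C l) *v x) \<bullet> (S j *v ((A l + L l ** C l) *v x))))
            \<le> x \<bullet> (S i *v x) - e i * (x \<bullet> x)"
          unfolding L_def[OF l]
        proof (rule closed_loop_decrease)
          show "e i * (x \<bullet> x) \<le> x \<bullet> (lmi_matrix (\<Upsilon>A i) (\<Upsilon>C i) (\<Upsilon>w i) (\<kappa>A i) (\<kappa>w i)
                              S (S i) (U i) (Lbar i) (lam i) (\<rho> i) *v x)" for x
            by (rule e(2))
        qed (use elim l U S_pos lam_\<rho>_pos \<kappa>_pos e(1) box_weight_nonneg[OF density_g] in
              \<open>auto simp: w_def less_imp_le\<close>)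
        also have "\<dots> \<le> x \<bullet> (S i *v x) - e0 * (x \<bullet> x)"
          using e0(2)[of i] by (simp add: mult_right_mono)
        finally show "(\<Sum>j\<in>UNIV. box_weight \<mu> g B l j *
            (((A l + L l ** C l) *v x) \<bullet> (S j *v ((A l + L l ** C l) *v x))))
            \<le> x \<bullet> (S i *v x) - e0 * (x \<bullet> x)"
          by (simp add: w_def)
      qed
    qed
  qed (fact sigma_finite density_g P.finite_partition_axioms S_pos e0(1))+
  with L_sup show "stoch_detectable_by \<mu> g C A L"
    by (simp add: stoch_detectable_by_def)
qed

end
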